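(* Fix $0\le\gamma<\alpha_-$. There exist $t_1\in(0,\min\{1,T\}]$ and $C>0$ such that $$\left|\partial_t^\gamma\mathcal M_{p,\alpha}(t)-c_*\frac{t^{\alpha-\gamma}}{\Gamma(1+\alpha-\gamma)}\right|\le C\,t^{2\alpha-\gamma}$$ for all $p\in\mathcal P$, $\alpha\in\mathcal A$, and $0<t\le t_1$. The constant $C$ depends only on the fixed a priori data $T,\alpha_-,\alpha_+,\gamma,M,p_0,f,\psi$ and $A$ (in particular not on $p$, $\alpha$, $t$).
   Context: Let $T>0$ and let $X$ be a separable Hilbert space with inner product $(\cdot,\cdot)_X$ (linear in the first argument) and norm $\|\cdot\|_X$. For $\alpha\in(0,1)$ the fractional Riemann--Liouville integral (Bochner integral) is $J^\alpha w(t):=\frac1{\Gamma(\alpha)}\int_0^t(t-s)^{\alpha-1}w(s)\,ds$, $0<t<T$. It is an injective operator on $L^2(0,T;X)$, and likewise on scalar-valued $L^2(0,T)$. Set $\partial_t^\alpha:=(J^\alpha)^{-1}$ with domain $H_\alpha(0,T;X):=J^\alpha L^2(0,T;X)$, and similarly for scalar-valued functions; $\partial_t^0$ and $J^0$ are the identity. Operator: $A:\mathcal D(A)\subset X\to X$ is densely defined, self-adjoint and negative, $-A\ge\lambda_1I$ for some $\lambda_1>0$, and $A$ has compact resolvent. Thus $-A=\sum_{n=1}^\infty\lambda_nP_n$ with $0<\lambda_1<\lambda_2<\cdots$ the distinct eigenvalues and $P_n$ the mutually orthogonal spectral projections. For $a,b>0$, $E_{a,b}(z):=\sum_{k=0}^\infty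 \frac{z^k}{\Gamma(ak+b)}$ is the two-parameter Mittag--Leffler function. Fix constants $0<\alpha_-<\alpha_+<1$, $p_0\ne0$, $M>|p_0|$, and put $\mathcal A:=[\alpha_-,\alpha_+]$, $\mathcal P:=\{p\in C^1[0,T]: p(0)=p_0,\ \|p\|_{C^1[0,T]}\le M\}$ (scalar-valued functions). Fix $f\in X$ and $\psi\in\mathcal D(A)$ with $c_*:=p_0(f,\psi)_X\ne0$. For $p\in\mathcal P$, $\alpha\in\mathcal A$, $u_{p,\alpha}\in H_\alpha(0,T;X)$ denotes the solution of $\partial_t^\alpha u(t)=Au(t)+p(t)f$, $t\in(0,T)$, given by $$u_{p,\alpha}(t)=\sum_{n=1}^\infty\int_0^t(t-s)^{\alpha-1}E_{\alpha,\alpha}\bigl(-\lambda_n(t-s)^\alpha\bigr)p(s)P_nf\,ds,$$ with the series convergent in $H_\alpha(0,T;X)\cap L^2(0,T;\mathcal D(A))$. The scalar observation is $\mathcal M_{p,\alpha}(t):=(u_{p,\alpha}(t),\psi)_X$, $0<t<T$. Pointwise values of $\partial_t^\gamma\mathcal M_{p,\alpha}$ (for $0\le\gamma<\alpha_-$) refer to the continuous representative. *)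

theory Defs
  imports "HOL-Analysis.Analysis"
begin

section \<open>Scalars and Hilbert spaces\<close>

text \<open>
  Real and complex Hilbert spaces are treated uniformly. By the Gelfand--Mazur theorem, \<open>real\<close> and
  \<open>complex\<close> are up to isomorphism the only models of the following class.
\<close>

class real_or_complex = real_normed_field + banach + second_countable_topology +
  fixes sconj :: "'a \<Rightarrow> 'a" and sre :: "'a \<Rightarrow> real"
  assumes sconj_add: "sconj (x + y) = sconj x + sconj y"
    and mult_sconj: "x * sconj x = (norm x)\<^sup>2 *\<^sub>R 1"
    and add_sconj: "x + sconj x = (2 * sre x) *\<^sub>R 1"

instantiation real :: real_or_complex
begin
definition "sconj (x::real) = x"
definition "sre (x::real) = x"
instance
  by standard (simp_all add: sconj_real_def sre_real_def power2_eq_square)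
end

instantiation complex :: real_or_complex
begin
definition "sconj (z::complex) = cnj z"
definition "sre (z::complex) = Re z"
instance
  by standard (simp_all add: sconj_complex_def sre_complex_def complex_eq_iff cmod_power2,
      simp_all add: power2_eq_square)
end

text \<open>
  Completeness and separability are the sort constraints \<open>banach\<close> and
  \<open>second_countable_topology\<close> on \<open>'x\<close>; the norm is the one of the type.
\<close>

locale hilbert_space = vector_space smul
  for smul :: "'k::real_or_complex \<Rightarrow> 'x::{banach,second_countable_topology} \<Rightarrow> 'x" +
  fixes ip :: "'x \<Rightarrow> 'x \<Rightarrow> 'k"
  assumes smul_of_real: "smul (of_real r) x = r *\<^sub>R x"
    and ip_add_left: "ip (x + y) z = ip x z + ip y z"
    and ip_smul_left: "ip (smul c x) y = c * ip x y"
    and ip_conj_sym: "ip y x = sconj (ip x y)"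
    and ip_self: "ip x x = of_real ((norm x)\<^sup>2)"

lemma hilbert_space_inner:
  "hilbert_space ((*\<^sub>R) :: real \<Rightarrow> 'x \<Rightarrow> 'x::{real_inner,banach,second_countable_topology}) (\<bullet>)"
  by unfold_locales
    (simp_all add: scaleR_add_right scaleR_add_left inner_add_left inner_add_right sconj_real_def inner_commute
      power2_norm_eq_inner)

lemma hilbert_space_complex: "hilbert_space ((*) :: complex \<Rightarrow> _) (\<lambda>x y. x * cnj y)"
  by unfold_locales
    (simp_all add: ring_distribs mult.assoc sconj_complex_def scaleR_conv_of_real mult.commute
      flip: complex_norm_square)


section \<open>Unbounded operators, given by a domain \<open>D\<close> and a function \<open>A\<close> relevant only on \<open>D\<close>\<close>

definition linear_operator ::
    "('k::field \<Rightarrow> 'x::ab_group_add \<Rightarrow> 'x) \<Rightarrow> 'x set \<Rightarrow> ('x \<Rightarrow> 'x) \<Rightarrow> bool" where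
  "linear_operator smul D A \<longleftrightarrow> module.subspace smul D \<and>
     (\<forall>x\<in>D. \<forall>y\<in>D. A (x + y) = A x + A y) \<and> (\<forall>c. \<forall>x\<in>D. A (smul c x) = smul c (A x))"

definition densely_defined :: "'x::topological_space set \<Rightarrow> bool" where
  "densely_defined D \<longleftrightarrow> closure D = UNIV"

definition adjoint_graph :: "('x \<Rightarrow> 'x \<Rightarrow> 'k) \<Rightarrow> 'x set \<Rightarrow> ('x \<Rightarrow> 'x) \<Rightarrow> ('x \<times> 'x) set" where
  "adjoint_graph ip D A = {(y, z). \<forall>x\<in>D. ip (A x) y = ip x z}"

definition self_adjoint :: "('x \<Rightarrow> 'x \<Rightarrow> 'k) \<Rightarrow> 'x set \<Rightarrow> ('x \<Rightarrow> 'x) \<Rightarrow> bool" where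
  "self_adjoint ip D A \<longleftrightarrow> adjoint_graph ip D A = (\<lambda>x. (x, A x)) ` D"

text \<open>\<open>B \<ge> c I\<close> in the sense of quadratic forms (real-valued for self-adjoint \<open>B\<close>)\<close>

definition bounded_below_by ::
    "('x::real_normed_vector \<Rightarrow> 'x \<Rightarrow> 'k::real_or_complex) \<Rightarrow> 'x set \<Rightarrow> ('x \<Rightarrow> 'x) \<Rightarrow> real \<Rightarrow> bool" where
  "bounded_below_by ip D B c \<longleftrightarrow> (\<forall>x\<in>D. c * (norm x)\<^sup>2 \<le> sre (ip (B x) x))"

definition resolvent_set ::
    "('k \<Rightarrow> 'x::real_normed_vector \<Rightarrow> 'x) \<Rightarrow> 'x set \<Rightarrow> ('x \<Rightarrow> 'x) \<Rightarrow> 'k set" where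
  "resolvent_set smul D A = {z. bij_betw (\<lambda>x. smul z x - A x) D UNIV \<and>
     (\<exists>K. \<forall>x\<in>D. norm x \<le> K * norm (smul z x - A x))}"

definition resolvent ::
    "('k \<Rightarrow> 'x::real_normed_vector \<Rightarrow> 'x) \<Rightarrow> 'x set \<Rightarrow> ('x \<Rightarrow> 'x) \<Rightarrow> 'k \<Rightarrow> 'x \<Rightarrow> 'x" where
  "resolvent smul D A z = the_inv_into D (\<lambda>x. smul z x - A x)"

definition compact_resolvent ::
    "('k \<Rightarrow> 'x::real_normed_vector \<Rightarrow> 'x) \<Rightarrow> 'x set \<Rightarrow> ('x \<Rightarrow> 'x) \<Rightarrow> bool" where
  "compact_resolvent smul D A \<longleftrightarrow>
     (\<exists>z\<in>resolvent_set smul D A. compact (closure (resolvent smul D A z ` cball 0 1)))"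

definition eigenspace ::
    "('k \<Rightarrow> 'x \<Rightarrow> 'x) \<Rightarrow> 'x set \<Rightarrow> ('x \<Rightarrow> 'x) \<Rightarrow> 'k \<Rightarrow> 'x set" where
  "eigenspace smul D A l = {x\<in>D. A x = smul l x}"

definition eigenvalues ::
    "('k \<Rightarrow> 'x::zero \<Rightarrow> 'x) \<Rightarrow> 'x set \<Rightarrow> ('x \<Rightarrow> 'x) \<Rightarrow> 'k set" where
  "eigenvalues smul D A = {l. \<exists>x\<in>eigenspace smul D A l. x \<noteq> 0}"

text \<open>
  \<open>lam 0 < lam 1 < \<dots>\<close> are all the eigenvalues of \<open>-A\<close>, each listed once; the numbering starts
  at 0.
\<close>

definition eigenvalue_enumeration ::
    "('k::real_algebra_1 \<Rightarrow> 'x::ab_group_add \<Rightarrow> 'x) \<Rightarrow> 'x set \<Rightarrow> ('x \<Rightarrow> 'x) \<Rightarrow> (nat \<Rightarrow> real) \<Rightarrow> bool" where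
  "eigenvalue_enumeration smul D A lam \<longleftrightarrow>
     strict_mono lam \<and> range (\<lambda>n. of_real (lam n)) = eigenvalues smul D (\<lambda>x. - A x)"

definition orth_proj :: "('x::ab_group_add \<Rightarrow> 'x \<Rightarrow> 'k::zero) \<Rightarrow> 'x set \<Rightarrow> 'x \<Rightarrow> 'x" where
  "orth_proj ip S x = (THE y. y \<in> S \<and> (\<forall>z\<in>S. ip (x - y) z = 0))"

definition spectral_proj ::
    "('k::real_algebra_1 \<Rightarrow> 'x::ab_group_add \<Rightarrow> 'x) \<Rightarrow> ('x \<Rightarrow> 'x \<Rightarrow> 'k) \<Rightarrow> 'x set \<Rightarrow> ('x \<Rightarrow> 'x) \<Rightarrow>
     (nat \<Rightarrow> real) \<Rightarrow> nat \<Rightarrow> 'x \<Rightarrow> 'x" where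
  "spectral_proj smul ip D A lam n = orth_proj ip (eigenspace smul D (\<lambda>x. - A x) (of_real (lam n)))"


section \<open>Fractional calculus on \<open>L\<^sup>2(0,T;X)\<close>\<close>

text \<open>
  Elements of \<open>L\<^sup>2(0,T;X)\<close> are represented by functions, identified almost everywhere on
  \<open>(0,T)\<close>. As \<open>X\<close> is separable, Borel and strong measurability agree.
\<close>

definition L2 :: "real \<Rightarrow> (real \<Rightarrow> 'x::{banach,second_countable_topology}) \<Rightarrow> bool" where
  "L2 T w \<longleftrightarrow> w \<in> borel_measurable (lebesgue_on {0<..<T}) \<and>
     integrable (lebesgue_on {0<..<T}) (\<lambda>t. (norm (w t))\<^sup>2)"

definition L2_tendsto ::
    "real \<Rightarrow> (nat \<Rightarrow> real \<Rightarrow> 'x::{banach,second_countable_topology}) \<Rightarrow> (real \<Rightarrow> 'x) \<Rightarrow> bool" where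
  "L2_tendsto T W w \<longleftrightarrow> (\<forall>N. L2 T (W N)) \<and> L2 T w \<and>
     (\<lambda>N. LINT t|lebesgue_on {0<..<T}. (norm (W N t - w t))\<^sup>2) \<longlonglongrightarrow> 0"

definition frac_integral ::
    "real \<Rightarrow> (real \<Rightarrow> 'x::{banach,second_countable_topology}) \<Rightarrow> real \<Rightarrow> 'x" where
  "frac_integral \<alpha> w t = (if \<alpha> = 0 then w t
     else (1 / Gamma \<alpha>) *\<^sub>R (LINT s|lebesgue_on {0<..<t}. ((t - s) powr (\<alpha> - 1)) *\<^sub>R w s))"

text \<open>
  \<open>has_frac_deriv T \<alpha> v w\<close>: \<open>v\<close> belongs to \<open>H\<^sub>\<alpha>(0,T;X)\<close>, the range of \<open>J\<^sup>\<alpha>\<close> on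
  \<open>L\<^sup>2(0,T;X)\<close>, and \<open>w\<close> represents \<open>(J\<^sup>\<alpha>)\<^sup>-\<^sup>1 v\<close>. By injectivity of \<open>J\<^sup>\<alpha>\<close>, \<open>w\<close> is unique
  almost everywhere.
\<close>

definition has_frac_deriv ::
    "real \<Rightarrow> real \<Rightarrow> (real \<Rightarrow> 'x::{banach,second_countable_topology}) \<Rightarrow> (real \<Rightarrow> 'x) \<Rightarrow> bool" where
  "has_frac_deriv T \<alpha> v w \<longleftrightarrow>
     L2 T w \<and> (AE t in lebesgue_on {0<..<T}. v t = frac_integral \<alpha> w t)"

text \<open>A continuous representative of the fractional derivative; its values on \<open>{0..T}\<close> are unique\<close>

definition has_cont_frac_deriv ::
    "real \<Rightarrow> real \<Rightarrow> (real \<Rightarrow> 'x::{banach,second_countable_topology}) \<Rightarrow> (real \<Rightarrow> 'x) \<Rightarrow> bool" where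
  "has_cont_frac_deriv T \<alpha> v w \<longleftrightarrow> has_frac_deriv T \<alpha> v w \<and> continuous_on {0..T} w"

definition mittag_leffler :: "real \<Rightarrow> real \<Rightarrow> 'a::{real_normed_field,banach} \<Rightarrow> 'a" where
  "mittag_leffler a b z = (\<Sum>k. z ^ k / of_real (Gamma (a * real k + b)))"


section \<open>Admissible time profiles and the solution\<close>

text \<open>Continuous differentiability on the closed interval, one-sided at the end points\<close>

definition C1_on :: "real \<Rightarrow> (real \<Rightarrow> 'k::real_normed_vector) \<Rightarrow> bool" where
  "C1_on T p \<longleftrightarrow> (\<forall>t\<in>{0..T}. p differentiable (at t within {0..T})) \<and>
     continuous_on {0..T} (\<lambda>t. vector_derivative p (at t within {0..T}))"

definition C1_norm :: "real \<Rightarrow> (real \<Rightarrow> 'k::real_normed_vector) \<Rightarrow> real" where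
  "C1_norm T p = (SUP t\<in>{0..T}. norm (p t)) +
     (SUP t\<in>{0..T}. norm (vector_derivative p (at t within {0..T})))"

definition admissible_profiles ::
    "real \<Rightarrow> 'k::real_normed_vector \<Rightarrow> real \<Rightarrow> (real \<Rightarrow> 'k) set" where
  "admissible_profiles T p0 M = {p. C1_on T p \<and> p 0 = p0 \<and> C1_norm T p \<le> M}"

definition series_term ::
    "('k::real_or_complex \<Rightarrow> 'x::{banach,second_countable_topology} \<Rightarrow> 'x) \<Rightarrow> ('x \<Rightarrow> 'x \<Rightarrow> 'k) \<Rightarrow>
     'x set \<Rightarrow> ('x \<Rightarrow> 'x) \<Rightarrow> (nat \<Rightarrow> real) \<Rightarrow> 'x \<Rightarrow> (real \<Rightarrow> 'k) \<Rightarrow> real \<Rightarrow> nat \<Rightarrow> real \<Rightarrow> 'x" where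
  "series_term smul ip D A lam f p \<alpha> n t =
     (LINT s|lebesgue_on {0<..<t}.
        smul (of_real ((t - s) powr (\<alpha> - 1) *
                 mittag_leffler \<alpha> \<alpha> (- lam n * (t - s) powr \<alpha>)) * p s)
          (spectral_proj smul ip D A lam n f))"

text \<open>
  \<open>u\<close> lies in \<open>H\<^sub>\<alpha>(0,T;X)\<close> and in \<open>L\<^sup>2(0,T;D(A))\<close> and solves \<open>\<partial>\<^sub>t\<^sup>\<alpha> u = A u + p f\<close>.
\<close>

definition solves_fde ::
    "('k \<Rightarrow> 'x::{banach,second_countable_topology} \<Rightarrow> 'x) \<Rightarrow> 'x set \<Rightarrow> ('x \<Rightarrow> 'x) \<Rightarrow> real \<Rightarrow> 'x \<Rightarrow>
     (real \<Rightarrow> 'k) \<Rightarrow> real \<Rightarrow> (real \<Rightarrow> 'x) \<Rightarrow> bool" where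
  "solves_fde smul D A T f p \<alpha> u \<longleftrightarrow>
     L2 T u \<and> L2 T (\<lambda>t. A (u t)) \<and> (AE t in lebesgue_on {0<..<T}. u t \<in> D) \<and>
     (\<exists>w. has_frac_deriv T \<alpha> u w \<and>
        (AE t in lebesgue_on {0<..<T}. w t = A (u t) + smul (p t) f))"

text \<open>
  The partial sums converge to \<open>u\<close> in \<open>H\<^sub>\<alpha>(0,T;X)\<close>, i.e. their fractional derivatives converge in
  \<open>L\<^sup>2(0,T;X)\<close> to that of \<open>u\<close>, and in \<open>L\<^sup>2(0,T;D(A))\<close> with the graph norm on \<open>D(A)\<close>.
\<close>

definition is_series_sum ::
    "'x set \<Rightarrow> ('x \<Rightarrow> 'x) \<Rightarrow> real \<Rightarrow> real \<Rightarrow>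
     (nat \<Rightarrow> real \<Rightarrow> 'x::{banach,second_countable_topology}) \<Rightarrow> (real \<Rightarrow> 'x) \<Rightarrow> bool" where
  "is_series_sum D A T \<alpha> v u \<longleftrightarrow>
     (let S = (\<lambda>N t. \<Sum>n<N. v n t) in
        (\<exists>W w. (\<forall>N. has_frac_deriv T \<alpha> (S N) (W N)) \<and> has_frac_deriv T \<alpha> u w \<and> L2_tendsto T W w) \<and>
        (\<forall>N. AE t in lebesgue_on {0<..<T}. S N t \<in> D) \<and>
        (AE t in lebesgue_on {0<..<T}. u t \<in> D) \<and>
        L2_tendsto T S u \<and> L2_tendsto T (\<lambda>N t. A (S N t)) (\<lambda>t. A (u t)))"

definition is_solution ::
    "('k::real_or_complex \<Rightarrow> 'x::{banach,second_countable_topology} \<Rightarrow> 'x) \<Rightarrow> ('x \<Rightarrow> 'x \<Rightarrow> 'k) \<Rightarrow>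
     'x set \<Rightarrow> ('x \<Rightarrow> 'x) \<Rightarrow> (nat \<Rightarrow> real) \<Rightarrow> real \<Rightarrow> 'x \<Rightarrow> (real \<Rightarrow> 'k) \<Rightarrow> real \<Rightarrow> (real \<Rightarrow> 'x) \<Rightarrow> bool" where
  "is_solution smul ip D A lam T f p \<alpha> u \<longleftrightarrow>
     solves_fde smul D A T f p \<alpha> u \<and>
     is_series_sum D A T \<alpha> (series_term smul ip D A lam f p \<alpha>) u"

end

theory Submission
  imports Defs
begin

text \<open>
  Pairing the equation with \<open>\<psi>\<close> moves \<open>A\<close> onto \<open>\<psi>\<close>: the \<open>\<alpha>\<close>-th derivative of the observation
  \<open>(u(t), \<psi>)\<close> is \<open>h(t) = (u(t), A \<psi>) + p(t) (f, \<psi>)\<close>. As \<open>h\<close> is bounded, the semigroup law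
  \<open>J\<^sup>\<gamma> J\<^sup>\<alpha>\<^sup>-\<^sup>\<gamma> = J\<^sup>\<alpha>\<close> shows that \<open>g = J\<^sup>\<alpha>\<^sup>-\<^sup>\<gamma> h\<close> is the \<open>\<gamma>\<close>-th derivative, and \<open>g\<close> is Hoelder
  continuous. The constant \<open>p0 (f, \<psi>)\<close> contributes to \<open>g\<close> exactly the leading term, so all that
  matters is \<open>|h(t) - p0 (f, \<psi>)| \<le> C t\<^sup>\<alpha>\<close> with \<open>C\<close> independent of \<open>p\<close> and \<open>\<alpha>\<close>; applying \<open>J\<^sup>\<alpha>\<^sup>-\<^sup>\<gamma>\<close> then
  gains the factor \<open>t\<^sup>\<alpha>\<^sup>-\<^sup>\<gamma>\<close>. The difference \<open>p(t) - p0\<close> is \<open>O(t)\<close>, hence \<open>O(t\<^sup>\<alpha>)\<close> for \<open>t \<le> 1\<close>, by the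
  \<open>C\<^sup>1\<close> bound, which leaves the pointwise bound \<open>\<parallel>u(t)\<parallel> \<le> C t\<^sup>\<alpha>\<close> (\<open>series_sum_norm_le\<close>).

  That bound comes from the series. Its \<open>n\<close>-th term is a scalar multiple of \<open>P\<^sub>n f\<close>, and the
  projections are mutually orthogonal, so by Bessel's inequality it is enough to bound the scalars
  uniformly in \<open>n\<close>. They are convolutions of \<open>p\<close> with
  \<open>e(t) = t\<^sup>\<alpha>\<^sup>-\<^sup>1 E\<^bsub>\<alpha>,\<alpha>\<^esub>(- \<lambda> t\<^sup>\<alpha>)\<close>, and the heart of the proof is the estimate
  \<open>0 \<le> e(t) \<le> t\<^sup>\<alpha>\<^sup>-\<^sup>1 / \<Gamma>(\<alpha>)\<close> (\<open>ml_kern_bounds\<close>), in which \<open>\<lambda>\<close> has disappeared.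

  With \<open>k(t) = t\<^sup>\<alpha>\<^sup>-\<^sup>1 / \<Gamma>(\<alpha>)\<close> the power series gives the Volterra equation \<open>e = k - \<lambda> (k * e)\<close>, so
  the upper bound follows from positivity. Positivity follows from the log-convexity of \<open>k\<close> by
  looking at a first zero \<open>t0\<close> of \<open>e\<close>: if \<open>r < t0\<close>, then \<open>k(t0 - s) / k(r - s) \<le> k(t0) / k(r)\<close>
  for \<open>s < r\<close>, and comparing the equations at \<open>r\<close> and \<open>t0\<close> yields
  \<open>(k(t0) / k(r)) e(r) \<le> \<lambda> \<integral>\<^sub>r\<^bsup>t0\<^esup> k(t0 - s) e(s) ds\<close>. There are \<open>r\<close>
  arbitrarily close to \<open>t0\<close> for which \<open>e(r)\<close> is the maximum of \<open>e\<close> on \<open>[r, t0]\<close>. For these the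
  inequality bounds \<open>k(t0) / k(r)\<close>, which tends to 1, by \<open>\<lambda> \<integral>\<^sub>r\<^bsup>t0\<^esup> k(t0 - s) ds\<close>, which tends to 0.
\<close>

section \<open>Riemann--Liouville kernels\<close>

text \<open>
  The convolution kernel of \<open>J\<^sup>a\<close>, extended by 0 so that its argument encodes the limits
  of integration.
\<close>

definition frac_kern :: "real \<Rightarrow> real \<Rightarrow> real" where
  "frac_kern a x = (if x > 0 then x powr (a - 1) / Gamma a else 0)"

lemma frac_kern_nonneg: "a > 0 \<Longrightarrow> 0 \<le> frac_kern a x"
  by (simp add: frac_kern_def)

lemma frac_kern_measurable [measurable]: "frac_kern a \<in> borel_measurable borel"
  unfolding frac_kern_def by measurable

text \<open>
  This is the Beta integral, rescaled from \<open>[0, 1]\<close> to \<open>[r, t]\<close>. Outside \<open>(r, t)\<close> one of the two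
  kernels vanishes, so all later convolutions can be integrated over one fixed interval.
\<close>

lemma frac_kern_convolution_lborel:
  assumes a: "a > 0" and b: "b > 0"
  shows "has_bochner_integral lborel (\<lambda>s. frac_kern a (t - s) * frac_kern b (s - r)) (frac_kern (a + b) (t - r))"
proof (cases "r < t")
  case True
  define c where "c = t - r"
  have c: "c > 0" using True by (simp add: c_def)
  define \<phi> where "\<phi> = (\<lambda>x::real. indicator {0..1} x * (x powr (b - 1) * (1 - x) powr (a - 1)))"
  have "set_integrable lborel {0..1} (\<lambda>x. x powr (b - 1) * (1 - x) powr (a - 1))"
    by (rule integrable_Beta[OF b a])
  then have int: "integrable lborel \<phi>"
    by (simp add: set_integrable_def \<phi>_def)
  have "(LINT x|lborel. \<phi> x) = Beta b a"
    using set_borel_integral_eq_integral(2)[OF integrable_Beta[OF b a]] has_integral_Beta_real[OF b a]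
    by (simp add: set_lebesgue_integral_def \<phi>_def integral_unique)
  then have "has_bochner_integral lborel \<phi> (Beta b a)"
    using int by (simp add: has_bochner_integral_iff)
  then have "has_bochner_integral lborel (\<lambda>x. \<phi> (- r / c + 1 / c * x)) (Beta b a /\<^sub>R \<bar>1 / c\<bar>)"
    using c by (subst (asm) lborel_has_bochner_integral_real_affine_iff[of "1/c" _ _ "-r/c"]) auto
  then have "has_bochner_integral lborel
      (\<lambda>x. (c powr (a - 1) * c powr (b - 1) / (Gamma a * Gamma b)) * \<phi> (- r / c + 1 / c * x))
      ((c powr (a - 1) * c powr (b - 1) / (Gamma a * Gamma b)) * (Beta b a /\<^sub>R \<bar>1 / c\<bar>))"
    by (rule has_bochner_integral_mult_right)
  moreover have "(c powr (a - 1) * c powr (b - 1) / (Gamma a * Gamma b)) * (Beta b a /\<^sub>R \<bar>1 / c\<bar>)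
      = frac_kern (a + b) (t - r)"
  proof -
    have "c powr (a - 1) * c powr (b - 1) * c = c powr (a + b - 1)"
    proof -
      have "c powr (a - 1) * c powr (b - 1) * c powr 1 = c powr (a + b - 1)"
        unfolding powr_add[symmetric] by (simp add: algebra_simps)
      then show ?thesis using c by simp
    qed
    then show ?thesis
      using c a b Gamma_real_pos[of a, THEN less_imp_neq] Gamma_real_pos[of b, THEN less_imp_neq]
      by (simp add: frac_kern_def c_def[symmetric] Beta_def field_simps)
  qed
  moreover have "AE x in lborel. (c powr (a - 1) * c powr (b - 1) / (Gamma a * Gamma b)) * \<phi> (- r / c + 1 / c * x)
      = frac_kern a (t - x) * frac_kern b (x - r)"
  proof -
    have "AE x in lborel. x \<noteq> r" "AE x in lborel. x \<noteq> t"
      by (auto intro: AE_lborel_singleton)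
    then show ?thesis
    proof eventually_elim
      case (elim x)
      have eq: "- r / c + 1 / c * x = (x - r) / c" "1 - (x - r) / c = (t - x) / c"
        using c by (simp_all add: field_simps) (simp add: c_def)
      show ?case
      proof (cases "r < x \<and> x < t")
        case True
        then have "(x - r) / c \<in> {0..1}" using c by (auto simp: field_simps c_def)
        then show ?thesis
          using True c unfolding \<phi>_def eq by (simp add: frac_kern_def powr_divide)
      next
        case False
        with elim have "(x - r) / c \<notin> {0..1}" using c by (auto simp: field_simps c_def)
        then show ?thesis using False elim unfolding \<phi>_def eq by (auto simp: frac_kern_def)
      qed
    qed
  qed
  ultimately show ?thesis
    by (subst has_bochner_integral_cong_AE[symmetric]) (auto simp: \<phi>_def)
next
  case False
  then have "(\<lambda>s. frac_kern a (t - s) * frac_kern b (s - r)) = (\<lambda>_. 0)"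
    by (auto simp: frac_kern_def)
  then show ?thesis
    using False by (simp add: frac_kern_def has_bochner_integral_zero)
qed

lemma has_bochner_integral_lborel_lebesgue_on:
  fixes f :: "real \<Rightarrow> 'b::{banach,second_countable_topology}"
  assumes f: "has_bochner_integral lborel f x" and zero: "\<And>s. s \<notin> S \<Longrightarrow> f s = 0" and S: "S \<in> sets lebesgue"
  shows "has_bochner_integral (lebesgue_on S) f x"
proof -
  have "has_bochner_integral lebesgue f x"
    using f by (auto simp: has_bochner_integral_iff integrable_completion integral_completion)
  moreover have "(\<lambda>s. indicator S s *\<^sub>R f s) = f"
    using zero by (auto simp: fun_eq_iff indicator_def)
  ultimately show ?thesis
    using S by (subst has_bochner_integral_restrict_space) auto
qed

lemma frac_kern_convolution:
  assumes "a > 0" "b > 0" "0 \<le> r" "t \<le> T"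
  shows "has_bochner_integral (lebesgue_on {0<..<T}) (\<lambda>s. frac_kern a (t - s) * frac_kern b (s - r)) (frac_kern (a + b) (t - r))"
  using assms
  by (intro has_bochner_integral_lborel_lebesgue_on frac_kern_convolution_lborel) (auto simp: frac_kern_def)

lemma frac_kern_one: "frac_kern 1 x = (if x > 0 then 1 else 0)"
  by (simp add: frac_kern_def)

lemma frac_kern_integral:
  assumes "a > 0" "0 \<le> t" "t \<le> T"
  shows "has_bochner_integral (lebesgue_on {0<..<T}) (\<lambda>s. frac_kern a (t - s)) (frac_kern (a + 1) t)"
proof -
  have "has_bochner_integral (lebesgue_on {0<..<T}) (\<lambda>s. frac_kern a (t - s)) (frac_kern (a + 1) t) \<longleftrightarrow>
    has_bochner_integral (lebesgue_on {0<..<T}) (\<lambda>s. frac_kern a (t - s) * frac_kern 1 (s - 0)) (frac_kern (a + 1) (t - 0))"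
    by (intro has_bochner_integral_cong) (auto simp: frac_kern_one)
  then show ?thesis using frac_kern_convolution[of a 1 0 t T] assms by simp
qed

lemma finite_measure_lebesgue_on: "finite_measure (lebesgue_on {0<..<T::real})"
  by (cases "0 \<le> T") (auto intro!: finite_measureI simp: emeasure_restrict_space)

lemma sigma_finite_lebesgue_on: "sigma_finite_measure (lebesgue_on {0<..<T::real})"
  using finite_measure_lebesgue_on by (rule finite_measure.axioms)

text \<open>
  Absorbing the upper limit \<open>t\<close> into the kernel makes the measure independent of \<open>t\<close>, so that
  iterated fractional integrals become integrals over a product measure.
\<close>

lemma frac_integral_kern:
  fixes w :: "real \<Rightarrow> 'x::{banach,second_countable_topology}"
  assumes "a \<noteq> 0" "t \<le> T"
  shows "frac_integral a w t = (LINT s|lebesgue_on {0<..<T}. frac_kern a (t - s) *\<^sub>R w s)"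
proof -
  have "frac_integral a w t = (1 / Gamma a) *\<^sub>R (LINT s|lebesgue_on {0<..<t}. ((t - s) powr (a - 1)) *\<^sub>R w s)"
    using assms by (simp add: frac_integral_def)
  also have "\<dots> = (LINT s|lebesgue_on {0<..<t}. (1 / Gamma a) *\<^sub>R ((t - s) powr (a - 1)) *\<^sub>R w s)"
    by (simp only: integral_scaleR_right)
  also have "\<dots> = (LINT s|lebesgue_on {0<..<t}. frac_kern a (t - s) *\<^sub>R w s)"
    by (intro Bochner_Integration.integral_cong) (auto simp: frac_kern_def)
  also have "\<dots> = (LINT s|lebesgue_on {0<..<T}. frac_kern a (t - s) *\<^sub>R w s)"
    using assms(2) by (simp add: integral_restrict_space)
      (auto simp: frac_kern_def indicator_def intro!: Bochner_Integration.integral_cong)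
  finally show ?thesis .
qed

section \<open>Fractional integrals\<close>

lemma measurable_lebesgue_on_borel [measurable (raw)]:
  "f \<in> borel_measurable borel \<Longrightarrow> f \<in> borel_measurable (lebesgue_on S)"
  by (intro measurable_restrict_space1 measurable_completion) auto

text \<open>
  Tonelli: integrating out \<open>s\<close> first turns the two kernels into one, so integrability against the
  single kernel of order \<open>a + b\<close> is enough.
\<close>

lemma frac_kern_fubini:
  fixes h :: "real \<Rightarrow> 'x::{banach,second_countable_topology}"
  defines "M T \<equiv> lebesgue_on {0<..<T::real}"
  assumes ab: "a > 0" "b > 0" and t: "t \<le> T"
    and h [measurable]: "h \<in> borel_measurable (M T)"
    and int: "integrable (M T) (\<lambda>r. frac_kern (a + b) (t - r) *\<^sub>R h r)"
  shows "integrable (M T \<Otimes>\<^sub>M M T) (\<lambda>(r, s). (frac_kern a (t - s) * frac_kern b (s - r)) *\<^sub>R h r)"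
proof -
  interpret pair_sigma_finite "M T" "M T"
    unfolding M_def by (intro pair_sigma_finite.intro sigma_finite_lebesgue_on)
  have id: "(\<lambda>x. x) \<in> borel_measurable (M T)"
    unfolding M_def by measurable
  have [measurable]: "fst \<in> borel_measurable (M T \<Otimes>\<^sub>M M T)" "snd \<in> borel_measurable (M T \<Otimes>\<^sub>M M T)"
    using measurable_compose[OF measurable_fst id] measurable_compose[OF measurable_snd id] by auto
  have conv: "has_bochner_integral (M T) (\<lambda>s. frac_kern a (t - s) * frac_kern b (s - r)) (frac_kern (a + b) (t - r))"
    if "r \<in> space (M T)" for r
    using that ab t unfolding M_def by (intro frac_kern_convolution) auto
  show ?thesis
  proof (rule Fubini_integrable)
    show "(\<lambda>(r, s). (frac_kern a (t - s) * frac_kern b (s - r)) *\<^sub>R h r) \<in> borel_measurable (M T \<Otimes>\<^sub>M M T)"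
      unfolding case_prod_beta by measurable
    have "integrable (M T) (\<lambda>r. norm (frac_kern (a + b) (t - r) *\<^sub>R h r))"
      by (rule integrable_norm[OF int])
    also have "?this \<longleftrightarrow> integrable (M T) (\<lambda>r. LINT s|M T. norm (case (r, s) of (r, s) \<Rightarrow>
        (frac_kern a (t - s) * frac_kern b (s - r)) *\<^sub>R h r))"
    proof (rule Bochner_Integration.integrable_cong[OF refl])
      fix r assume r: "r \<in> space (M T)"
      have "(LINT s|M T. norm (case (r, s) of (r, s) \<Rightarrow> (frac_kern a (t - s) * frac_kern b (s - r)) *\<^sub>R h r))
          = (LINT s|M T. (frac_kern a (t - s) * frac_kern b (s - r)) * norm (h r))"
        using ab by (simp add: frac_kern_nonneg)
      also have "\<dots> = frac_kern (a + b) (t - r) * norm (h r)"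
        using has_bochner_integral_mult_left[OF conv[OF r]] has_bochner_integral_integral_eq by blast
      also have "\<dots> = norm (frac_kern (a + b) (t - r) *\<^sub>R h r)"
        using ab by (simp add: frac_kern_nonneg)
      finally show "norm (frac_kern (a + b) (t - r) *\<^sub>R h r) = (LINT s|M T. norm (case (r, s) of (r, s) \<Rightarrow>
        (frac_kern a (t - s) * frac_kern b (s - r)) *\<^sub>R h r))" ..
    qed
    finally show "integrable (M T) (\<lambda>r. LINT s|M T. norm (case (r, s) of (r, s) \<Rightarrow>
        (frac_kern a (t - s) * frac_kern b (s - r)) *\<^sub>R h r))" .
    show "AE r in M T. integrable (M T) (\<lambda>s. case (r, s) of (r, s) \<Rightarrow> (frac_kern a (t - s) * frac_kern b (s - r)) *\<^sub>R h r)"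
      using conv by (intro AE_I2) (auto simp: has_bochner_integral_iff)
  qed
qed

text \<open>
  Fubini reduces the law to the convolution of the two kernels.
\<close>

lemma frac_integral_semigroup:
  fixes h :: "real \<Rightarrow> 'x::{banach,second_countable_topology}"
  assumes ab: "a > 0" "b > 0" and t: "t \<le> T"
    and h: "h \<in> borel_measurable (lebesgue_on {0<..<T})"
    and int: "integrable (lebesgue_on {0<..<T}) (\<lambda>r. frac_kern (a + b) (t - r) *\<^sub>R h r)"
  shows "frac_integral a (frac_integral b h) t = frac_integral (a + b) h t"
proof -
  let ?M = "lebesgue_on {0<..<T}"
  interpret pair_sigma_finite ?M ?M
    by (intro pair_sigma_finite.intro sigma_finite_lebesgue_on)
  have "frac_integral a (frac_integral b h) t = (LINT s|?M. frac_kern a (t - s) *\<^sub>R frac_integral b h s)"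
    using ab t by (simp add: frac_integral_kern)
  also have "\<dots> = (LINT s|?M. frac_kern a (t - s) *\<^sub>R (LINT r|?M. frac_kern b (s - r) *\<^sub>R h r))"
    using ab by (intro Bochner_Integration.integral_cong) (auto simp: frac_integral_kern[of b _ T])
  also have "\<dots> = (LINT s|?M. (LINT r|?M. (frac_kern a (t - s) * frac_kern b (s - r)) *\<^sub>R h r))"
    by (simp flip: integral_scaleR_right scaleR_scaleR)
  also have "\<dots> = (LINT r|?M. (LINT s|?M. (frac_kern a (t - s) * frac_kern b (s - r)) *\<^sub>R h r))"
    using frac_kern_fubini[OF ab t h int] by (rule Fubini_integral)
  also have "\<dots> = (LINT r|?M. frac_kern (a + b) (t - r) *\<^sub>R h r)"
  proof (rule Bochner_Integration.integral_cong[OF refl])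
    fix r assume "r \<in> space ?M"
    then have "has_bochner_integral ?M (\<lambda>s. frac_kern a (t - s) * frac_kern b (s - r)) (frac_kern (a + b) (t - r))"
      using ab t by (intro frac_kern_convolution) auto
    then show "(LINT s|?M. (frac_kern a (t - s) * frac_kern b (s - r)) *\<^sub>R h r) = frac_kern (a + b) (t - r) *\<^sub>R h r"
      by (intro has_bochner_integral_integral_eq has_bochner_integral_scaleR_left)
  qed
  also have "\<dots> = frac_integral (a + b) h t"
    using ab t by (simp add: frac_integral_kern[of _ _ T])
  finally show ?thesis .
qed

text \<open>
  Since the kernel of order 1 is the Heaviside function, this is the case \<open>a = 1\<close>, \<open>t = T\<close> of
  \<open>frac_kern_fubini\<close>, in which the kernel of order \<open>1 + b\<close> is bounded. For \<open>b \<le> 1 / 2\<close> the integrand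
  need not be integrable for every \<open>s\<close>, even if \<open>h\<close> is square integrable.
\<close>

lemma AE_integrable_kern:
  fixes h :: "real \<Rightarrow> 'x::{banach,second_countable_topology}"
  assumes b: "b > 0" and int: "integrable (lebesgue_on {0<..<T}) h"
  shows "AE s in lebesgue_on {0<..<T}. integrable (lebesgue_on {0<..<T}) (\<lambda>r. frac_kern b (s - r) *\<^sub>R h r)"
proof -
  let ?M = "lebesgue_on {0<..<T}"
  interpret pair_sigma_finite ?M ?M
    by (intro pair_sigma_finite.intro sigma_finite_lebesgue_on)
  have [measurable]: "h \<in> borel_measurable ?M"
    using int by auto
  have "integrable ?M (\<lambda>r. frac_kern (1 + b) (T - r) *\<^sub>R h r)"
  proof (rule Bochner_Integration.integrable_bound)
    show "integrable ?M (\<lambda>r. (T powr b / Gamma (1 + b)) *\<^sub>R h r)"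
      using int by auto
    have "(T - r) powr b \<le> T powr b" if "r \<in> {0<..<T}" for r
      using that b by (intro powr_mono2) auto
    then show "AE r in ?M. norm (frac_kern (1 + b) (T - r) *\<^sub>R h r) \<le> norm ((T powr b / Gamma (1 + b)) *\<^sub>R h r)"
      using b by (intro AE_I2) (auto simp: frac_kern_def Gamma_real_pos[THEN less_imp_le] intro!: mult_right_mono divide_right_mono)
    show "(\<lambda>r. frac_kern (1 + b) (T - r) *\<^sub>R h r) \<in> borel_measurable ?M"
      by measurable
  qed
  then have "AE s in ?M. integrable ?M (\<lambda>r. (frac_kern 1 (T - s) * frac_kern b (s - r)) *\<^sub>R h r)"
    using b by (intro AE_integrable_snd frac_kern_fubini) auto
  then show ?thesis
    by (rule AE_mp) (auto simp: frac_kern_one)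
qed

lemma frac_kern_scaleR_integrable:
  fixes w :: "real \<Rightarrow> 'x::{banach,second_countable_topology}"
  assumes b: "b > 0" and t: "0 \<le> t" "t \<le> T"
    and w [measurable]: "w \<in> borel_measurable (lebesgue_on {0<..<T})"
    and bound: "AE s in lebesgue_on {0<..<T}. s < t \<longrightarrow> norm (w s) \<le> B"
  shows "integrable (lebesgue_on {0<..<T}) (\<lambda>s. frac_kern b (t - s) *\<^sub>R w s)"
proof (rule Bochner_Integration.integrable_bound)
  show "integrable (lebesgue_on {0<..<T}) (\<lambda>s. frac_kern b (t - s) * B)"
    using frac_kern_integral[OF b t] by (auto simp: has_bochner_integral_iff)
  show "(\<lambda>s. frac_kern b (t - s) *\<^sub>R w s) \<in> borel_measurable (lebesgue_on {0<..<T})"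
    by measurable
  show "AE s in lebesgue_on {0<..<T}. norm (frac_kern b (t - s) *\<^sub>R w s) \<le> norm (frac_kern b (t - s) * B)"
    using bound
  proof eventually_elim
    case (elim s)
    show ?case
    proof (cases "s < t")
      case True
      then show ?thesis using elim b by (auto simp: abs_mult intro!: mult_left_mono)
    qed (simp add: frac_kern_def)
  qed
qed

lemma frac_integral_norm_le:
  fixes w :: "real \<Rightarrow> 'x::{banach,second_countable_topology}"
  assumes b: "b > 0" and t: "0 \<le> t" "t \<le> T"
    and w: "w \<in> borel_measurable (lebesgue_on {0<..<T})"
    and bound: "AE s in lebesgue_on {0<..<T}. s < t \<longrightarrow> norm (w s) \<le> B"
  shows "norm (frac_integral b w t) \<le> B * frac_kern (b + 1) t"
proof -
  let ?M = "lebesgue_on {0<..<T}"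
  note int = frac_kern_scaleR_integrable[OF assms]
  have K: "has_bochner_integral ?M (\<lambda>s. frac_kern b (t - s)) (frac_kern (b + 1) t)"
    by (rule frac_kern_integral[OF b t])
  have "norm (frac_integral b w t) \<le> (LINT s|?M. norm (frac_kern b (t - s) *\<^sub>R w s))"
    using b t by (simp add: frac_integral_kern[of _ _ T] del: norm_scaleR)
  also have "\<dots> \<le> (LINT s|?M. B * frac_kern b (t - s))"
  proof (rule integral_mono_AE)
    show "AE s in ?M. norm (frac_kern b (t - s) *\<^sub>R w s) \<le> B * frac_kern b (t - s)"
      using bound
    proof eventually_elim
      case (elim s)
      show ?case
      proof (cases "s < t")
        case True
        then show ?thesis using elim b by (simp add: frac_kern_nonneg mult.commute[of B] mult_left_mono)
      qed (simp add: frac_kern_def)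
    qed
    show "integrable ?M (\<lambda>s. norm (frac_kern b (t - s) *\<^sub>R w s))"
      by (rule integrable_norm[OF int])
  qed (use K in \<open>auto simp: has_bochner_integral_iff\<close>)
  also have "\<dots> = B * frac_kern (b + 1) t"
    using K by (simp add: has_bochner_integral_iff)
  finally show ?thesis .
qed

text \<open>
  The kernel \<open>k\<close> of order \<open>b\<close> is decreasing on the positive half-line, so
  \<open>|k(t' - s) - k(t - s)|\<close> is \<open>k(t - s) - k(t' - s)\<close> for \<open>s < t\<close> and \<open>k(t' - s)\<close> for
  \<open>t < s < t'\<close>; both parts integrate explicitly.
\<close>

lemma frac_integral_holder:
  fixes w :: "real \<Rightarrow> 'x::{banach,second_countable_topology}"
  assumes b: "0 < b" "b < 1" and t: "0 \<le> t" "t \<le> t'" "t' \<le> T"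
    and w: "w \<in> borel_measurable (lebesgue_on {0<..<T})"
    and B: "0 \<le> B"
    and bound: "AE s in lebesgue_on {0<..<T}. norm (w s) \<le> B"
  shows "norm (frac_integral b w t' - frac_integral b w t) \<le> B * (2 * frac_kern (b + 1) (t' - t))"
proof -
  let ?M = "lebesgue_on {0<..<T}"
  let ?d = "\<lambda>s. frac_kern b (t - s) - frac_kern b (t' - s) + 2 * (frac_kern b (t' - s) * frac_kern 1 (s - t))"
  have int: "integrable ?M (\<lambda>s. frac_kern b (r - s) *\<^sub>R w s)" if "0 \<le> r" "r \<le> T" for r
    using that b w bound by (intro frac_kern_scaleR_integrable[of _ _ _ _ B]) auto
  have K1: "has_bochner_integral ?M (\<lambda>s. frac_kern b (t - s)) (frac_kern (b + 1) t)"
    and K2: "has_bochner_integral ?M (\<lambda>s. frac_kern b (t' - s)) (frac_kern (b + 1) t')"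
    and K3: "has_bochner_integral ?M (\<lambda>s. frac_kern b (t' - s) * frac_kern 1 (s - t)) (frac_kern (b + 1) (t' - t))"
    using b t by (auto intro!: frac_kern_integral frac_kern_convolution)
  have K: "has_bochner_integral ?M ?d (frac_kern (b + 1) t - frac_kern (b + 1) t' + 2 * frac_kern (b + 1) (t' - t))"
    by (intro has_bochner_integral_add has_bochner_integral_diff has_bochner_integral_mult_right K1 K2 K3)
  have le: "\<bar>frac_kern b (t' - s) - frac_kern b (t - s)\<bar> \<le> ?d s" if "s \<noteq> t" for s
  proof (cases "s < t")
    case True
    then have "(t' - s) powr (b - 1) \<le> (t - s) powr (b - 1)"
      using t b by (intro powr_mono2') auto
    then show ?thesis using True t b by (simp add: frac_kern_def Gamma_real_pos[THEN less_imp_le] divide_right_mono)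
  next
    case False
    with that show ?thesis using b by (auto simp: frac_kern_def)
  qed
  have "frac_integral b w t' - frac_integral b w t
      = (LINT s|?M. frac_kern b (t' - s) *\<^sub>R w s) - (LINT s|?M. frac_kern b (t - s) *\<^sub>R w s)"
    using t b by (simp add: frac_integral_kern[of _ _ T])
  also have "\<dots> = (LINT s|?M. frac_kern b (t' - s) *\<^sub>R w s - frac_kern b (t - s) *\<^sub>R w s)"
    using t int by (subst Bochner_Integration.integral_diff) auto
  also have "norm \<dots> \<le> (LINT s|?M. norm (frac_kern b (t' - s) *\<^sub>R w s - frac_kern b (t - s) *\<^sub>R w s))"
    by (rule integral_norm_bound)
  also have "\<dots> \<le> (LINT s|?M. B * ?d s)"
  proof (rule integral_mono_AE)
    show "integrable ?M (\<lambda>s. norm (frac_kern b (t' - s) *\<^sub>R w s - frac_kern b (t - s) *\<^sub>R w s))"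
      using t by (intro integrable_norm Bochner_Integration.integrable_diff int) auto
    show "integrable ?M (\<lambda>s. B * ?d s)"
      using K by (intro integrable_mult_right) (auto simp: has_bochner_integral_iff)
    have "AE s in lebesgue. s \<noteq> t"
      by (rule AE_completion, rule AE_lborel_singleton)
    then have "AE s in ?M. s \<noteq> t"
      by (auto simp: AE_restrict_space_iff)
    then show "AE s in ?M. norm (frac_kern b (t' - s) *\<^sub>R w s - frac_kern b (t - s) *\<^sub>R w s) \<le> B * ?d s"
      using bound
    proof eventually_elim
      case (elim s)
      have "norm (frac_kern b (t' - s) *\<^sub>R w s - frac_kern b (t - s) *\<^sub>R w s) = \<bar>frac_kern b (t' - s) - frac_kern b (t - s)\<bar> * norm (w s)"
        by (simp flip: scaleR_left_diff_distrib)
      also have "\<dots> \<le> ?d s * B"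
        using elim le[of s] by (intro mult_mono) auto
      finally show ?case by (simp add: mult.commute)
    qed
  qed
  also have "\<dots> = B * (frac_kern (b + 1) t - frac_kern (b + 1) t' + 2 * frac_kern (b + 1) (t' - t))"
    using has_bochner_integral_mult_right[OF K] by (intro has_bochner_integral_integral_eq) auto
  also have "\<dots> \<le> B * (2 * frac_kern (b + 1) (t' - t))"
  proof -
    have "t powr b \<le> t' powr b" using t b by (intro powr_mono2) auto
    then have "frac_kern (b + 1) t \<le> frac_kern (b + 1) t'"
      using t b by (simp add: frac_kern_def Gamma_real_pos[THEN less_imp_le] divide_right_mono)
    then show ?thesis using B by (intro mult_left_mono) auto
  qed
  finally show ?thesis .
qed

lemma continuous_on_frac_integral:
  fixes w :: "real \<Rightarrow> 'x::{banach,second_countable_topology}"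
  assumes b: "0 < b" "b < 1"
    and w: "w \<in> borel_measurable (lebesgue_on {0<..<T})"
    and bound: "AE s in lebesgue_on {0<..<T}. norm (w s) \<le> B"
  shows "continuous_on {0..T} (frac_integral b w)"
proof -
  \<comment> \<open>If \<open>T \<le> 0\<close>, the hypothesis does not force \<open>B\<close> to be nonnegative.\<close>
  define B' where "B' = max B 0"
  have bound': "AE s in lebesgue_on {0<..<T}. norm (w s) \<le> B'"
    using bound by (rule AE_mp) (auto simp: B'_def)
  have H: "norm (frac_integral b w y - frac_integral b w x) \<le> B' * (2 * (\<bar>y - x\<bar> powr b / Gamma (b + 1)))"
    if "x \<in> {0..T}" "y \<in> {0..T}" for x y
  proof (cases "x \<le> y")
    case True
    then show ?thesis
      using frac_integral_holder[OF b _ True _ w _ bound'] that b by (auto simp: B'_def frac_kern_def split: if_splits)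
  next
    case False
    then have "y \<le> x" by simp
    then show ?thesis
      using frac_integral_holder[OF b _ \<open>y \<le> x\<close> _ w _ bound'] that b False
      by (auto simp: B'_def frac_kern_def norm_minus_commute split: if_splits)
  qed
  show ?thesis
    unfolding continuous_on_def
  proof
    fix x assume x: "x \<in> {0..T}"
    have "((\<lambda>y. B' * (2 * (\<bar>y - x\<bar> powr b / Gamma (b + 1)))) \<longlongrightarrow> B' * (2 * (0 / Gamma (b + 1)))) (at x within {0..T})"
      using b Gamma_real_pos[of "b + 1", THEN less_imp_neq]
      by (intro tendsto_intros tendsto_zero_powrI[of _ _ _ b]) (auto intro!: tendsto_eq_intros)
    then have "((\<lambda>y. B' * (2 * (\<bar>y - x\<bar> powr b / Gamma (b + 1)))) \<longlongrightarrow> 0) (at x within {0..T})"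
      by simp
    then have "((\<lambda>y. frac_integral b w y - frac_integral b w x) \<longlongrightarrow> 0) (at x within {0..T})"
      by (rule Lim_null_comparison[rotated]) (use x H in \<open>auto simp: eventually_at_filter\<close>)
    then show "(frac_integral b w \<longlongrightarrow> frac_integral b w x) (at x within {0..T})"
      by (rule LIM_zero_cancel)
  qed
qed

section \<open>The Mittag--Leffler kernel\<close>

text \<open>
  Log-convexity of \<open>\<Gamma>\<close> on the segment from \<open>y + a\<close> to \<open>y + a + 1\<close>, evaluated at \<open>y + 1\<close>.
\<close>

lemma Gamma_ratio_le:
  assumes y: "y > 0" and a: "0 < a" "a < 1"
  shows "y * Gamma y \<le> Gamma (y + a) * (y + a) powr (1 - a :: real)"
proof -
  have pos: "Gamma (y + a) > 0" using y a by simp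
  have "ln (Gamma ((1 - (1 - a)) *\<^sub>R (y + a) + (1 - a) *\<^sub>R (y + a + 1))) \<le> (1 - (1 - a)) * ln (Gamma (y + a)) + (1 - a) * ln (Gamma (y + a + 1))"
    using convex_onD[OF log_convex_Gamma_real, of "1 - a" "y + a" "y + a + 1"] y a by simp
  also have "(1 - (1 - a)) *\<^sub>R (y + a) + (1 - a) *\<^sub>R (y + a + 1) = y + 1"
    by (simp add: algebra_simps)
  also have "Gamma (y + a + 1) = (y + a) * Gamma (y + a)"
    using y a by (intro Gamma_plus1) (auto elim!: nonpos_Ints_cases)
  also have "ln \<dots> = ln (y + a) + ln (Gamma (y + a))"
    using y a pos by (intro ln_mult_pos) auto
  also have "(1 - (1 - a)) * ln (Gamma (y + a)) + (1 - a) * (ln (y + a) + ln (Gamma (y + a)))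
      = ln (Gamma (y + a)) + (1 - a) * ln (y + a)"
    by (simp add: algebra_simps)
  also have "\<dots> = ln (Gamma (y + a) * (y + a) powr (1 - a))"
    using y a pos by (simp add: ln_mult_pos ln_powr)
  finally have "Gamma (y + 1) \<le> Gamma (y + a) * (y + a) powr (1 - a)"
    using y a pos by (subst (asm) ln_le_cancel_iff) auto
  moreover have "Gamma (y + 1) = y * Gamma y"
    using y by (intro Gamma_plus1) (auto elim!: nonpos_Ints_cases)
  ultimately show ?thesis by simp
qed

text \<open>
  By \<open>Gamma_ratio_le\<close> the quotient \<open>\<Gamma>(y) / \<Gamma>(y + a)\<close> is \<open>O(y\<^sup>-\<^sup>a)\<close>, so the ratio test applies.
\<close>

lemma summable_mittag_leffler:
  assumes a: "0 < a" "a < (1::real)"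
  shows "summable (\<lambda>k. (x::real) ^ k / Gamma (a * real k + a))"
proof -
  have "filterlim (\<lambda>k. a * real k + a) at_top sequentially"
  proof (rule filterlim_at_top_mono)
    show "filterlim (\<lambda>k. a * real k) at_top sequentially"
      using a by (intro filterlim_tendsto_pos_mult_at_top[OF tendsto_const] filterlim_real_sequentially)
  qed (use a in simp)
  then have "(\<lambda>k. (a * real k + a) powr (- a)) \<longlonglongrightarrow> 0"
    using a by (intro tendsto_neg_powr) auto
  then have "(\<lambda>k. 2 * \<bar>x\<bar> * (a * real k + a) powr (- a)) \<longlonglongrightarrow> 0"
    by (rule tendsto_mult_right_zero)
  then have "\<forall>\<^sub>F k in sequentially. 2 * \<bar>x\<bar> * (a * real k + a) powr (- a) < 1 / 2"
    by (rule order_tendstoD) simp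
  then obtain N where N: "\<And>k. k \<ge> N \<Longrightarrow> 2 * \<bar>x\<bar> * (a * real k + a) powr (- a) < 1 / 2"
    by (auto simp: eventually_sequentially)
  show ?thesis
  proof (rule summable_ratio_test[of "1/2" N])
    fix k assume k: "k \<ge> N"
    define y where "y = a * real k + a"
    have y: "y > 0" "y \<ge> a" using a by (auto simp: y_def add_nonneg_pos)
    have G: "Gamma y > 0" "Gamma (y + a) > 0" using y a by auto
    have "y * Gamma y \<le> Gamma (y + a) * (2 * y powr (1 - a))"
    proof -
      have "(y + a) powr (1 - a) \<le> (2 * y) powr (1 - a)"
        using y a by (intro powr_mono2) auto
      also have "\<dots> = 2 powr (1 - a) * y powr (1 - a)"
        using y by (simp add: powr_mult)
      also have "2 powr (1 - a) \<le> 2 powr (1::real)"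
        using a by (intro powr_mono) auto
      finally have "(y + a) powr (1 - a) \<le> 2 * y powr (1 - a)"
        by (simp add: mult_right_mono)
      then show ?thesis
        using Gamma_ratio_le[OF y(1) a] G by (smt (verit) mult_left_mono)
    qed
    then have "Gamma y \<le> Gamma (y + a) * (2 * y powr (- a))"
      using y by (simp add: powr_diff powr_minus field_simps)
    then have "1 / Gamma (y + a) \<le> 2 * y powr (- a) * (1 / Gamma y)"
      using G by (simp add: field_simps)
    then have "\<bar>x\<bar> * (1 / Gamma (y + a)) \<le> \<bar>x\<bar> * (2 * y powr (- a) * (1 / Gamma y))"
      by (rule mult_left_mono) simp
    also have "\<dots> = (2 * \<bar>x\<bar> * y powr (- a)) * (1 / Gamma y)"
      by simp
    also have "\<dots> \<le> (1/2) * (1 / Gamma y)"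
      using N[OF k] G by (intro mult_right_mono) (auto simp: y_def)
    finally have *: "\<bar>x\<bar> * (1 / Gamma (y + a)) \<le> (1/2) * (1 / Gamma y)" .
    have "norm (x ^ Suc k / Gamma (a * real (Suc k) + a)) = \<bar>x\<bar> ^ k * (\<bar>x\<bar> * (1 / Gamma (y + a)))"
      using G by (simp add: y_def abs_mult power_abs algebra_simps)
    also have "\<dots> \<le> \<bar>x\<bar> ^ k * ((1/2) * (1 / Gamma y))"
      using * by (intro mult_left_mono) auto
    also have "\<dots> = 1/2 * norm (x ^ k / Gamma (a * real k + a))"
      using G by (simp add: y_def power_abs)
    finally show "norm (x ^ Suc k / Gamma (a * real (Suc k) + a)) \<le> 1/2 * norm (x ^ k / Gamma (a * real k + a))" .
  qed simp
qed

lemma isCont_mittag_leffler: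
  assumes a: "0 < a" "a < (1::real)"
  shows "isCont (mittag_leffler a a) (x::real)"
proof -
  have "isCont (\<lambda>x. \<Sum>k. (1 / Gamma (a * real k + a)) * x ^ k) x"
    by (rule isCont_powser_converges_everywhere) (use summable_mittag_leffler[OF a] in simp)
  then show ?thesis by (simp add: mittag_leffler_def[abs_def])
qed

text \<open>
  The kernel \<open>t\<^sup>a\<^sup>-\<^sup>1 E\<^bsub>a,a\<^esub>(- l t\<^sup>a)\<close> for \<open>t > 0\<close> (see \<open>ml_kern_eq\<close>), written as a series of Riemann--Liouville
  kernels so that convolutions can be taken term by term.
\<close>

definition ml_kern :: "real \<Rightarrow> real \<Rightarrow> real \<Rightarrow> real" where
  "ml_kern a l t = (\<Sum>k. (- l) ^ k * frac_kern (a * real k + a) t)"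

lemma frac_kern_powser:
  assumes a: "0 < a" and t: "t > 0"
  shows "l ^ k * frac_kern (a * real k + a) t = t powr (a - 1) * ((l * t powr a) ^ k / Gamma (a * real k + a))"
proof -
  have "t powr (a * real k + a - 1) = t powr (a - 1 + a * real k)" by (simp add: algebra_simps)
  also have "\<dots> = t powr (a - 1) * (t powr a) ^ k"
    using t by (simp only: powr_add powr_powr[symmetric] powr_realpow) (simp add: powr_realpow)
  finally show ?thesis using t by (simp add: frac_kern_def power_mult_distrib)
qed

lemma summable_ml_kern:
  assumes a: "0 < a" "a < 1"
  shows "summable (\<lambda>k. l ^ k * frac_kern (a * real k + a) t)"
proof (cases "t > 0")
  case True
  then show ?thesis
    using summable_mult[OF summable_mittag_leffler[OF a, of "l * t powr a"], of "t powr (a - 1)"] a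
    by (simp add: frac_kern_powser)
qed (simp add: frac_kern_def)

lemma ml_kern_eq:
  assumes a: "0 < a" "a < 1" and t: "t > 0"
  shows "ml_kern a l t = t powr (a - 1) * mittag_leffler a a (- l * t powr a)"
  using suminf_mult[OF summable_mittag_leffler[OF a, of "- l * t powr a"], of "t powr (a - 1)"] a t
  by (simp add: frac_kern_powser ml_kern_def mittag_leffler_def)

lemma ml_kern_eq_0: "t \<le> 0 \<Longrightarrow> ml_kern a l t = 0"
  by (simp add: ml_kern_def frac_kern_def)

lemma ml_kern_measurable [measurable]: "ml_kern a l \<in> borel_measurable borel"
  unfolding ml_kern_def by measurable

lemma continuous_on_ml_kern:
  assumes a: "0 < a" "a < 1"
  shows "continuous_on {0<..} (ml_kern a l)"
proof -
  have "continuous_on {0<..} (\<lambda>t. t powr (a - 1) * mittag_leffler a a (- l * t powr a))"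
  proof (rule continuous_on_mult)
    show "continuous_on {0<..} (\<lambda>t. mittag_leffler a a (- l * t powr a))"
    proof (rule continuous_on_compose2[where g = "mittag_leffler a a" and f = "\<lambda>t. - l * t powr a" and t = UNIV])
      show "continuous_on UNIV (mittag_leffler a a :: real \<Rightarrow> real)"
        using isCont_mittag_leffler[OF a] by (simp add: continuous_at_imp_continuous_on)
      show "continuous_on {0<..} (\<lambda>t. - l * t powr a)"
        by (intro continuous_intros) auto
    qed simp
  qed (intro continuous_intros, auto)
  also have "?this \<longleftrightarrow> ?thesis"
    by (intro continuous_on_cong) (simp_all add: ml_kern_eq[OF a])
  finally show ?thesis .
qed

text \<open>
  Convolving with the kernel of order \<open>a\<close> raises the order of every term of the series by \<open>a\<close>, that is,
  it shifts the series by one place.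
\<close>

lemma ml_kern_volterra:
  assumes a: "0 < a" "a < 1" and t: "t \<le> T"
  shows "integrable (lebesgue_on {0<..<T}) (\<lambda>s. frac_kern a (t - s) * ml_kern a l s)" (is ?int)
    and "ml_kern a l t = frac_kern a t - l * (LINT s|lebesgue_on {0<..<T}. frac_kern a (t - s) * ml_kern a l s)" (is ?eq)
proof -
  let ?M = "lebesgue_on {0<..<T}"
  define g where "g = (\<lambda>c k s. frac_kern a (t - s) * (c ^ k * frac_kern (a * real k + a) s))"
  have g: "has_bochner_integral ?M (g c k) (c ^ k * frac_kern (a * real (Suc k) + a) t)" for c k
  proof -
    have "has_bochner_integral ?M (\<lambda>s. frac_kern a (t - s) * frac_kern (a * real k + a) (s - 0)) (frac_kern (a + (a * real k + a)) (t - 0))"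
      using a t by (intro frac_kern_convolution) (auto simp: add_nonneg_pos)
    from has_bochner_integral_mult_right[OF this, of "c ^ k"] show ?thesis
      by (simp add: g_def algebra_simps)
  qed
  \<comment> \<open>The norms of the terms are the terms of the series with \<open>\<bar>l\<bar>\<close> in place of \<open>- l\<close>.\<close>
  have norm_g: "norm (g (- l) k s) = g \<bar>l\<bar> k s" for k s
    using a by (simp add: g_def abs_mult power_abs frac_kern_nonneg add_nonneg_pos)
  have int: "integrable ?M (g (- l) k)" for k
    using g by (auto simp: has_bochner_integral_iff)
  have sum1: "AE s in ?M. summable (\<lambda>k. norm (g (- l) k s))"
    unfolding norm_g unfolding g_def by (intro AE_I2 summable_mult summable_ml_kern a)
  have shift: "summable (\<lambda>k. c ^ k * frac_kern (a * real (Suc k) + a) t)" for c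
  proof (cases "c = 0")
    case True
    then show ?thesis by (intro summable_finite[of "{0}"]) auto
  next
    case False
    have "summable (\<lambda>k. c ^ Suc k * frac_kern (a * real (Suc k) + a) t)"
      by (subst summable_Suc_iff) (rule summable_ml_kern[OF a])
    from summable_mult[OF this, of "1 / c"] show ?thesis using False by simp
  qed
  have sum2: "summable (\<lambda>k. LINT s|?M. norm (g (- l) k s))"
    unfolding norm_g using g[of "\<bar>l\<bar>"] shift by (simp add: has_bochner_integral_iff)
  have eq: "(\<Sum>k. g (- l) k s) = frac_kern a (t - s) * ml_kern a l s" for s
    unfolding g_def ml_kern_def by (rule suminf_mult[OF summable_ml_kern[OF a]])
  show ?int
    using integrable_suminf[OF int sum1 sum2] by (simp add: eq)
  have "(LINT s|?M. frac_kern a (t - s) * ml_kern a l s) = (\<Sum>k. LINT s|?M. g (- l) k s)"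
    using integral_suminf[OF int sum1 sum2] by (simp add: eq)
  also have "\<dots> = (\<Sum>k. (- l) ^ k * frac_kern (a * real (Suc k) + a) t)"
    using g[of "- l"] by (simp add: has_bochner_integral_iff)
  finally have "- l * (LINT s|?M. frac_kern a (t - s) * ml_kern a l s) = - l * (\<Sum>k. (- l) ^ k * frac_kern (a * real (Suc k) + a) t)"
    by simp
  also have "\<dots> = (\<Sum>k. (- l) ^ Suc k * frac_kern (a * real (Suc k) + a) t)"
    using suminf_mult[OF shift, of "- l" "- l"] by (simp add: mult.assoc)
  also have "\<dots> = ml_kern a l t - frac_kern a t"
    using suminf_split_head[OF summable_ml_kern[OF a, of "- l" t]] by (simp add: ml_kern_def)
  finally show ?eq by simp
qed

text \<open>
  Log-convexity of the kernel in multiplicative form, for the four points \<open>r - s\<close>, \<open>r\<close>, \<open>t - s\<close>, \<open>t\<close>: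
  as the exponent \<open>a - 1\<close> is negative, it amounts to \<open>t (r - s) \<le> (t - s) r\<close>.
\<close>

lemma frac_kern_log_convex:
  assumes a: "0 < a" "a < 1" and st: "s < r" "0 \<le> s" "r \<le> t"
  shows "frac_kern a (t - s) * frac_kern a r \<le> frac_kern a t * frac_kern a (r - s)"
proof -
  have "s * r \<le> s * t" using st by (intro mult_left_mono) auto
  then have "t * (r - s) \<le> (t - s) * r" by (simp add: algebra_simps)
  then have "((t - s) * r) powr (a - 1) \<le> (t * (r - s)) powr (a - 1)"
    using a st by (intro powr_mono2') auto
  then have "(t - s) powr (a - 1) * r powr (a - 1) \<le> t powr (a - 1) * (r - s) powr (a - 1)"
    using st by (simp add: powr_mult)
  then show ?thesis
    using st a by (simp add: frac_kern_def divide_right_mono)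
qed

text \<open>
  The first-zero argument: a zero of a solution of the Volterra equation is incompatible with the
  log-convexity of the kernel.
\<close>

lemma ml_kern_pos:
  assumes a: "0 < a" "a < 1" and l: "0 < l" and t: "0 < t"
  shows "0 < ml_kern a l t"
proof (rule ccontr)
  let ?e = "ml_kern a l"
  assume nt: "\<not> 0 < ?e t"
  have "((\<lambda>s. - l * s powr a) \<longlongrightarrow> 0) (at_right 0)"
    using a by (intro tendsto_mult_right_zero tendsto_zero_powrI[of _ _ _ a])
      (auto intro!: tendsto_eq_intros simp: eventually_at_filter)
  then have "((\<lambda>s. mittag_leffler a a (- l * s powr a)) \<longlongrightarrow> mittag_leffler a a 0) (at_right 0)"
    using isCont_mittag_leffler[OF a, of 0] by (rule isCont_tendsto_compose[rotated])
  moreover have "mittag_leffler a a 0 = 1 / Gamma a"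
    using powser_zero[of "\<lambda>k. 1 / Gamma (a * real k + a)"] by (simp add: mittag_leffler_def)
  ultimately have "\<forall>\<^sub>F s in at_right 0. 0 < mittag_leffler a a (- l * s powr a)"
    using order_tendstoD(1)[of _ "1 / Gamma a" _ 0] a by simp
  then obtain d where d: "d > 0" "\<And>s. 0 < s \<Longrightarrow> s < d \<Longrightarrow> 0 < ?e s"
    by (auto simp: eventually_at_right_field ml_kern_eq[OF a])
  \<comment> \<open>Near 0 the kernel behaves like \<open>t\<^sup>a\<^sup>-\<^sup>1 / \<Gamma>(a)\<close>, so there is a first zero \<open>t0\<close>.\<close>
  define Z where "Z = {s \<in> {d..t}. ?e s \<le> 0}"
  have "d \<le> t" using d nt t by (meson not_le)
  have "closed Z"
  proof -
    have "continuous_on {d..t} ?e"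
      using d by (intro continuous_on_subset[OF continuous_on_ml_kern[OF a]]) auto
    then have "closed ({d..t} \<inter> ?e -` {..0})"
      by (intro continuous_closed_preimage) auto
    also have "{d..t} \<inter> ?e -` {..0} = Z" by (auto simp: Z_def)
    finally show ?thesis .
  qed
  moreover have "t \<in> Z" using nt \<open>d \<le> t\<close> by (auto simp: Z_def)
  moreover have "bdd_below Z" by (auto simp: Z_def intro!: bdd_belowI[of _ d])
  ultimately have "Inf Z \<in> Z" by (intro closed_contains_Inf) auto
  define t0 where "t0 = Inf Z"
  have t0: "t0 \<ge> d" "?e t0 \<le> 0" "t0 > 0" using \<open>Inf Z \<in> Z\<close> d by (auto simp: Z_def t0_def)
  have pos: "?e s > 0" if "0 < s" "s < t0" for s
  proof (rule ccontr)
    assume "\<not> ?e s > 0"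
    then have "s \<in> Z" using that d(2)[of s] \<open>Inf Z \<in> Z\<close> by (force simp: Z_def t0_def)
    then have "t0 \<le> s" unfolding t0_def using \<open>bdd_below Z\<close> by (rule cInf_lower)
    then show False using that by simp
  qed
  \<comment> \<open>Choose \<open>t1 < t0\<close> so that on \<open>(t1, t0)\<close> the final inequality is violated.\<close>
  have "((\<lambda>s. frac_kern a t0 / frac_kern a s - l * frac_kern (a + 1) (t0 - s)) \<longlongrightarrow> frac_kern a t0 / frac_kern a t0 - l * 0) (at_left t0)"
  proof (intro tendsto_intros)
    have "\<forall>\<^sub>F s in at_left t0. s \<in> {0<..<t0}"
      using t0 by (intro eventually_at_leftI[of 0]) auto
    then have ev: "\<forall>\<^sub>F s in at_left t0. s powr (a - 1) / Gamma a = frac_kern a s"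
      "\<forall>\<^sub>F s in at_left t0. (t0 - s) powr a / Gamma (a + 1) = frac_kern (a + 1) (t0 - s)"
      by (auto elim!: eventually_mono simp: frac_kern_def)
    have "((\<lambda>s. s powr (a - 1) / Gamma a) \<longlongrightarrow> t0 powr (a - 1) / Gamma a) (at_left t0)"
      using t0 a by (intro tendsto_intros) (auto simp: Gamma_real_pos[THEN less_imp_neq, symmetric])
    then have "(frac_kern a \<longlongrightarrow> t0 powr (a - 1) / Gamma a) (at_left t0)"
      using ev(1) by (rule Lim_transform_eventually)
    then show "(frac_kern a \<longlongrightarrow> frac_kern a t0) (at_left t0)"
      using t0 by (simp add: frac_kern_def[of a t0])
    have "((\<lambda>s. (t0 - s) powr a / Gamma (a + 1)) \<longlongrightarrow> 0 / Gamma (a + 1)) (at_left t0)"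
      using t0 a by (intro tendsto_intros tendsto_zero_powrI[of _ _ _ a])
        (auto simp: Gamma_real_pos[THEN less_imp_neq, symmetric] eventually_at_filter intro!: tendsto_eq_intros)
    then have "((\<lambda>s. frac_kern (a + 1) (t0 - s)) \<longlongrightarrow> 0 / Gamma (a + 1)) (at_left t0)"
      using ev(2) by (rule Lim_transform_eventually)
    then show "((\<lambda>s. frac_kern (a + 1) (t0 - s)) \<longlongrightarrow> 0) (at_left t0)"
      by simp
    show "frac_kern a t0 \<noteq> 0" using t0 a by (simp add: frac_kern_def Gamma_real_pos[THEN less_imp_neq, symmetric])
  qed
  moreover have "frac_kern a t0 / frac_kern a t0 - l * 0 > 0"
    using t0 a by (simp add: frac_kern_def Gamma_real_pos[THEN less_imp_neq, symmetric])
  ultimately have "\<forall>\<^sub>F s in at_left t0. frac_kern a t0 / frac_kern a s - l * frac_kern (a + 1) (t0 - s) > 0"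
    by (rule order_tendstoD)
  then obtain t1 where t1: "t1 < t0" "\<And>s. t1 < s \<Longrightarrow> s < t0 \<Longrightarrow> frac_kern a t0 / frac_kern a s > l * frac_kern (a + 1) (t0 - s)"
    by (auto simp: eventually_at_left_field)
  define t2 where "t2 = max ((t1 + t0) / 2) (t0 / 2)"
  have t2: "t1 < t2" "t2 < t0" "0 < t2" using t1 t0 by (auto simp: t2_def less_max_iff_disj)
  have "continuous_on {t2..t0} ?e"
    using t2 by (intro continuous_on_subset[OF continuous_on_ml_kern[OF a]]) auto
  \<comment> \<open>As \<open>e(t2) > 0 \<ge> e(t0)\<close>, the maximiser \<open>r\<close> differs from \<open>t0\<close> and \<open>e(r) > 0\<close>.\<close>
  then obtain r where r: "r \<in> {t2..t0}" "\<And>s. s \<in> {t2..t0} \<Longrightarrow> ?e s \<le> ?e r"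
    using continuous_attains_sup[of "{t2..t0}" ?e] t2 by auto
  have er: "?e r > 0" using r(2)[of t2] pos[of t2] t2 by auto
  then have r0: "0 < r" "r < t0" using r t2 t0 by (auto intro: le_neq_trans)
  let ?M = "lebesgue_on {0<..<t0}"
  have I1: "integrable ?M (\<lambda>s. frac_kern a (t0 - s) * ?e s)" and I2: "integrable ?M (\<lambda>s. frac_kern a (r - s) * ?e s)"
    using r0 by (auto intro!: ml_kern_volterra(1) a)
  have I3: "has_bochner_integral ?M (\<lambda>s. frac_kern a (t0 - s) * frac_kern 1 (s - r)) (frac_kern (a + 1) (t0 - r))"
    using r0 a by (intro frac_kern_convolution) auto
  have kr: "frac_kern a r > 0" using r0 a by (simp add: frac_kern_def)
  have "(LINT s|?M. frac_kern a (t0 - s) * ?e s)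
      \<le> (LINT s|?M. (frac_kern a t0 / frac_kern a r) * (frac_kern a (r - s) * ?e s) + ?e r * (frac_kern a (t0 - s) * frac_kern 1 (s - r)))"
  proof (rule integral_mono_AE[OF I1])
    show "integrable ?M (\<lambda>s. (frac_kern a t0 / frac_kern a r) * (frac_kern a (r - s) * ?e s) + ?e r * (frac_kern a (t0 - s) * frac_kern 1 (s - r)))"
      using I2 I3 by (auto simp: has_bochner_integral_iff)
    have "AE s in lebesgue. s \<noteq> r"
      by (rule AE_completion, rule AE_lborel_singleton)
    then have "AE s in ?M. s \<noteq> r"
      by (auto simp: AE_restrict_space_iff)
    moreover have "AE s in ?M. s \<in> {0<..<t0}"
      by (intro AE_I2) auto
    ultimately show "AE s in ?M. frac_kern a (t0 - s) * ?e s
        \<le> (frac_kern a t0 / frac_kern a r) * (frac_kern a (r - s) * ?e s) + ?e r * (frac_kern a (t0 - s) * frac_kern 1 (s - r))"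
    proof eventually_elim
      case (elim s)
      show ?case
      proof (cases "s < r")
        case True
        have "frac_kern a (t0 - s) * frac_kern a r \<le> frac_kern a t0 * frac_kern a (r - s)"
          using True elim r0 by (intro frac_kern_log_convex a) auto
        then have "frac_kern a (t0 - s) \<le> (frac_kern a t0 / frac_kern a r) * frac_kern a (r - s)"
          using kr by (simp add: field_simps)
        then have "frac_kern a (t0 - s) * ?e s \<le> (frac_kern a t0 / frac_kern a r) * frac_kern a (r - s) * ?e s"
          using elim pos[of s] by (intro mult_right_mono) auto
        then show ?thesis using True by (simp add: frac_kern_one mult.assoc)
      next
        case False
        then have "?e s \<le> ?e r" using elim r by auto
        then have "frac_kern a (t0 - s) * ?e s \<le> ?e r * frac_kern a (t0 - s)"
          using a by (subst mult.commute) (intro mult_right_mono, auto simp: frac_kern_nonneg)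
        then show ?thesis using False elim by (simp add: frac_kern_one) (simp add: frac_kern_def)
      qed
    qed
  qed
  also have "\<dots> = (frac_kern a t0 / frac_kern a r) * (LINT s|?M. frac_kern a (r - s) * ?e s) + ?e r * frac_kern (a + 1) (t0 - r)"
    using I2 I3 by (simp add: has_bochner_integral_iff)
  finally have "l * (LINT s|?M. frac_kern a (t0 - s) * ?e s) \<le> l * ((frac_kern a t0 / frac_kern a r) * (LINT s|?M. frac_kern a (r - s) * ?e s) + ?e r * frac_kern (a + 1) (t0 - r))"
    using l by (intro mult_left_mono) auto
  also have "\<dots> = (frac_kern a t0 / frac_kern a r) * (l * (LINT s|?M. frac_kern a (r - s) * ?e s)) + ?e r * (l * frac_kern (a + 1) (t0 - r))"
    by (simp add: algebra_simps)
  also have "l * (LINT s|?M. frac_kern a (r - s) * ?e s) = frac_kern a r - ?e r"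
    using ml_kern_volterra(2)[OF a, of r t0 l] r0 by simp
  also have "(frac_kern a t0 / frac_kern a r) * (frac_kern a r - ?e r) = frac_kern a t0 - (frac_kern a t0 / frac_kern a r) * ?e r"
    using kr by (simp add: field_simps)
  also have "l * (LINT s|?M. frac_kern a (t0 - s) * ?e s) = frac_kern a t0 - ?e t0"
    using ml_kern_volterra(2)[OF a, of t0 t0 l] by simp
  finally have "(frac_kern a t0 / frac_kern a r) * ?e r \<le> (l * frac_kern (a + 1) (t0 - r)) * ?e r"
    using t0 by (simp add: mult.commute)
  then have "frac_kern a t0 / frac_kern a r \<le> l * frac_kern (a + 1) (t0 - r)"
    using er by (rule mult_right_le_imp_le)
  then show False
    using t1(2)[of r] r t2 r0 by auto
qed

lemma ml_kern_bounds:
  assumes a: "0 < a" "a < 1" and l: "0 < l"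
  shows "0 \<le> ml_kern a l t" "ml_kern a l t \<le> frac_kern a t"
proof -
  show nn: "0 \<le> ml_kern a l t" for t
    using ml_kern_pos[OF a l, of t] ml_kern_eq_0[of t] by (cases "t > 0") auto
  have "0 \<le> l * (LINT s|lebesgue_on {0<..<t}. frac_kern a (t - s) * ml_kern a l s)"
    using a l nn by (intro mult_nonneg_nonneg Bochner_Integration.integral_nonneg) (auto simp: frac_kern_nonneg)
  then show "ml_kern a l t \<le> frac_kern a t"
    using ml_kern_volterra(2)[OF a, of t t l] by simp
qed

section \<open>Hilbert spaces and spectral projections\<close>

text \<open>
  The axioms determine the conjugation; this formula, which at 0 uses \<open>0 / 0 = 0\<close>, yields its
  multiplicativity and isometry.
\<close>

lemma sconj_eq: "sconj x = of_real ((norm x)\<^sup>2) / (x :: 'k::real_or_complex)"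
proof (cases "x = 0")
  case True
  have "sconj (0 + 0 :: 'k) = sconj 0 + sconj 0" by (rule sconj_add)
  then show ?thesis using True by simp
next
  case False
  then show ?thesis
    using mult_sconj[of x] by (simp add: of_real_def[symmetric] nonzero_eq_divide_eq mult.commute)
qed

lemma sconj_mult: "sconj (x * y) = sconj x * sconj (y :: 'k::real_or_complex)"
  by (simp add: sconj_eq norm_mult power_mult_distrib)

lemma sconj_of_real [simp]: "sconj (of_real r :: 'k::real_or_complex) = of_real r"
  by (simp add: sconj_eq power2_eq_square flip: of_real_divide)

lemma norm_sconj [simp]: "norm (sconj x) = norm (x :: 'k::real_or_complex)"
  by (simp add: sconj_eq norm_divide norm_mult power2_eq_square)

lemma sconj_0 [simp]: "sconj (0 :: 'k::real_or_complex) = 0"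
  by (simp add: sconj_eq)

lemma sre_of_real [simp]: "sre (of_real r :: 'k::real_or_complex) = r"
proof -
  have "(of_real (2 * r) :: 'k) = of_real (2 * sre (of_real r :: 'k))"
    using add_sconj[of "of_real r :: 'k"] by (simp add: of_real_def[symmetric])
  then show ?thesis by (simp only: of_real_eq_iff)
qed

context hilbert_space
begin

lemma ip_add_right: "ip x (y + z) = ip x y + ip x z"
  by (metis ip_add_left ip_conj_sym sconj_add)

lemma ip_smul_right: "ip x (smul c y) = sconj c * ip x y"
  by (metis ip_smul_left ip_conj_sym sconj_mult)

lemma ip_scaleR_left: "ip (r *\<^sub>R x) y = r *\<^sub>R ip x y"
  using ip_smul_left[of "of_real r" x y] by (simp add: smul_of_real scaleR_conv_of_real)

lemma ip_scaleR_right: "ip x (r *\<^sub>R y) = r *\<^sub>R ip x y"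
  using ip_smul_right[of x "of_real r" y] by (simp add: smul_of_real scaleR_conv_of_real)

lemma ip_minus_left: "ip (- x) y = - ip x y"
  using ip_scaleR_left[of "-1" x y] by simp

lemma ip_minus_right: "ip x (- y) = - ip x y"
  using ip_scaleR_right[of x "-1" y] by simp

lemma ip_diff_left: "ip (x - y) z = ip x z - ip y z"
  using ip_add_left[of x "- y" z] by (simp add: ip_minus_left)

lemma ip_diff_right: "ip x (y - z) = ip x y - ip x z"
  using ip_add_right[of x y "- z"] by (simp add: ip_minus_right)

lemma ip_zero_left [simp]: "ip 0 x = 0"
  using ip_scaleR_left[of 0 0 x] by simp

lemma ip_zero_right [simp]: "ip x 0 = 0"
  using ip_scaleR_right[of x 0 0] by simp

lemma ip_eq_0_sym: "ip x y = 0 \<Longrightarrow> ip y x = 0"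
  using ip_conj_sym[of y x] by simp

lemma ip_sum_left: "ip (\<Sum>i\<in>I. x i) y = (\<Sum>i\<in>I. ip (x i) y)"
  by (induction I rule: infinite_finite_induct) (auto simp: ip_add_left)

lemma ip_sum_right: "ip x (\<Sum>i\<in>I. y i) = (\<Sum>i\<in>I. ip x (y i))"
  by (induction I rule: infinite_finite_induct) (auto simp: ip_add_right)

lemma norm_smul: "norm (smul c x) = norm c * norm x"
proof -
  have "(of_real ((norm (smul c x))\<^sup>2) :: 'k) = (c * sconj c) * of_real ((norm x)\<^sup>2)"
    unfolding ip_self[symmetric] by (simp add: ip_smul_left ip_smul_right)
  also have "\<dots> = of_real ((norm c * norm x)\<^sup>2)"
    by (simp add: mult_sconj of_real_def[symmetric] power_mult_distrib)
  finally have "(norm (smul c x))\<^sup>2 = (norm c * norm x)\<^sup>2"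
    by (simp only: of_real_eq_iff)
  then show ?thesis by (simp add: power2_eq_iff_nonneg)
qed

lemma pythagoras:
  assumes "ip x y = 0"
  shows "(norm (x + y))\<^sup>2 = (norm x)\<^sup>2 + (norm y)\<^sup>2"
proof -
  have "(of_real ((norm (x + y))\<^sup>2) :: 'k) = of_real ((norm x)\<^sup>2 + (norm y)\<^sup>2)"
    unfolding of_real_add ip_self[symmetric]
    using assms ip_eq_0_sym[OF assms] by (simp add: ip_add_left ip_add_right)
  then show ?thesis by (simp only: of_real_eq_iff)
qed

lemma parallelogram:
  fixes x y :: 'x
  shows "(norm (x + y))\<^sup>2 + (norm (x - y))\<^sup>2 = ((norm x)\<^sup>2 + (norm x)\<^sup>2) + ((norm y)\<^sup>2 + (norm y)\<^sup>2)"
proof -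
  have "ip (x + y) (x + y) + ip (x - y) (x - y) = (ip x x + ip x x) + (ip y y + ip y y)"
    by (simp add: ip_add_left ip_add_right ip_diff_left ip_diff_right)
  then have "(of_real ((norm (x + y))\<^sup>2 + (norm (x - y))\<^sup>2) :: 'k)
      = of_real (((norm x)\<^sup>2 + (norm x)\<^sup>2) + ((norm y)\<^sup>2 + (norm y)\<^sup>2))"
    by (simp only: ip_self of_real_add)
  then show ?thesis by (simp only: of_real_eq_iff)
qed

text \<open>
  Removing the component along \<open>z\<close>. Nonnegativity of the left side is the Cauchy--Schwarz
  inequality; minimality of a distance forces the subtracted term to vanish, which gives orthogonality
  of the projection.
\<close>

lemma norm_sub_component:
  assumes z: "z \<noteq> 0"
  shows "(norm (x - smul (ip x z / of_real ((norm z)\<^sup>2)) z))\<^sup>2 = (norm x)\<^sup>2 - (norm (ip x z))\<^sup>2 / (norm z)\<^sup>2"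
proof -
  define c where "c = ip x z / of_real ((norm z)\<^sup>2)"
  have "ip (x - smul c z) (smul c z) = 0"
    using z by (simp add: ip_smul_right ip_diff_left ip_smul_left ip_self c_def)
  from pythagoras[OF this]
  have "(norm x)\<^sup>2 = (norm (x - smul c z))\<^sup>2 + (norm c)\<^sup>2 * (norm z)\<^sup>2"
    by (simp add: norm_smul power_mult_distrib)
  moreover have "(norm c)\<^sup>2 * (norm z)\<^sup>2 = (norm (ip x z))\<^sup>2 / (norm z)\<^sup>2"
    using z by (simp add: c_def norm_divide norm_mult norm_power power2_eq_square)
  ultimately show ?thesis by (simp add: c_def)
qed

lemma cauchy_schwarz: "norm (ip x y) \<le> norm x * norm y"
proof (cases "y = 0")
  case False
  have "0 \<le> (norm x)\<^sup>2 - (norm (ip x y))\<^sup>2 / (norm y)\<^sup>2"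
    unfolding norm_sub_component[OF False, symmetric] by simp
  then have "(norm (ip x y))\<^sup>2 \<le> (norm x * norm y)\<^sup>2"
    using False by (simp add: field_simps power_mult_distrib)
  then show ?thesis by (rule power2_le_imp_le) simp
qed simp

lemma bounded_linear_ip_left: "bounded_linear (\<lambda>x. ip x y)"
  by (rule bounded_linear_intro[where K = "norm y"])
    (auto simp: ip_add_left ip_scaleR_left cauchy_schwarz)

lemma bounded_linear_ip_right: "bounded_linear (ip x)"
  by (rule bounded_linear_intro[where K = "norm x"])
    (use cauchy_schwarz[of x] in \<open>auto simp: ip_add_right ip_scaleR_right mult.commute\<close>)

lemma bounded_linear_smul_left: "bounded_linear (\<lambda>c. smul c x)"
proof (rule bounded_linear_intro[where K = "norm x"])
  show "smul (r *\<^sub>R c) x = r *\<^sub>R smul c x" for r c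
    by (simp add: scaleR_conv_of_real smul_of_real flip: scale_scale)
qed (auto simp: norm_smul scale_left_distrib)

text \<open>
  A minimising sequence for the distance from \<open>x\<close> to \<open>S\<close> is Cauchy by the parallelogram law, and its
  limit is the projection.
\<close>

lemma orth_proj_exists:
  assumes S: "subspace S" "closed S"
  shows "\<exists>y\<in>S. \<forall>z\<in>S. ip (x - y) z = 0"
proof -
  define d where "d = (INF s\<in>S. (norm (x - s))\<^sup>2)"
  have bdd: "bdd_below ((\<lambda>s. (norm (x - s))\<^sup>2) ` S)"
    by (rule bdd_belowI2[of _ 0]) simp
  have ne: "S \<noteq> {}" using subspace_0[OF S(1)] by auto
  have d_le: "d \<le> (norm (x - s))\<^sup>2" if "s \<in> S" for s
    unfolding d_def using bdd that by (rule cINF_lower)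
  have "\<exists>s\<in>S. (norm (x - s))\<^sup>2 < d + 1 / real (Suc n)" for n
  proof -
    have "(INF s\<in>S. (norm (x - s))\<^sup>2) < d + 1 / real (Suc n)"
      unfolding d_def[symmetric] by simp
    then show ?thesis using bdd ne by (subst (asm) cINF_less_iff) auto
  qed
  then obtain s where s: "\<And>n. s n \<in> S" "\<And>n. (norm (x - s n))\<^sup>2 < d + 1 / real (Suc n)"
    by metis
  have dist_le: "(norm (s n - s m))\<^sup>2 \<le> 2 / real (Suc n) + 2 / real (Suc m)" for n m
  proof -
    define q where "q = (1/2) *\<^sub>R (s n + s m)"
    have "q \<in> S"
      unfolding q_def using subspace_scale[OF S(1) subspace_add[OF S(1) s(1)[of n] s(1)[of m]], of "of_real (1/2)"]
      by (simp add: smul_of_real del: of_real_divide)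
    have "(x - s n) + (x - s m) = 2 *\<^sub>R (x - q)"
      by (simp add: q_def algebra_simps scaleR_2)
    then have "(norm ((x - s n) + (x - s m)))\<^sup>2 = 4 * (norm (x - q))\<^sup>2"
      by (simp add: power_mult_distrib)
    moreover have "(x - s n) - (x - s m) = - (s n - s m)" by simp
    then have "norm ((x - s n) - (x - s m)) = norm (s n - s m)" by (simp only: norm_minus_cancel)
    ultimately have "4 * (norm (x - q))\<^sup>2 + (norm (s n - s m))\<^sup>2 = 2 * (norm (x - s n))\<^sup>2 + 2 * (norm (x - s m))\<^sup>2"
      using parallelogram[of "x - s n" "x - s m"] by simp
    then show ?thesis using d_le[OF \<open>q \<in> S\<close>] s(2)[of n] s(2)[of m] by simp
  qed
  have "Cauchy s"
  proof (rule CauchyI)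
    fix e :: real assume e: "e > 0"
    obtain N where N: "4 / e\<^sup>2 < real N" using reals_Archimedean2 by blast
    have "norm (s m - s n) < e" if "m \<ge> N" "n \<ge> N" for m n
    proof -
      have "0 < real N" using N e by (smt (verit) divide_pos_pos zero_less_power)
      then have "2 / real (Suc m) < 2 / real N" "2 / real (Suc n) < 2 / real N"
        using that by (auto intro!: divide_strict_left_mono mult_pos_pos)
      then have "(norm (s m - s n))\<^sup>2 < 4 / real N" using dist_le[of m n] by simp
      also have "\<dots> < e\<^sup>2" using N e \<open>0 < real N\<close> by (simp add: field_simps)
      finally show ?thesis using e by (simp add: power2_less_imp_less)
    qed
    then show "\<exists>N. \<forall>m\<ge>N. \<forall>n\<ge>N. norm (s m - s n) < e" by blast
  qed
  then obtain y where y: "s \<longlonglongrightarrow> y" by (auto simp: Cauchy_convergent_iff convergent_def)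
  have "y \<in> S" using S(2) s(1) y by (rule closed_sequentially)
  have "(norm (x - y))\<^sup>2 \<le> d"
  proof (rule LIMSEQ_le)
    show "(\<lambda>n. (norm (x - s n))\<^sup>2) \<longlonglongrightarrow> (norm (x - y))\<^sup>2" by (intro tendsto_intros y)
    show "(\<lambda>n. d + 1 / real (Suc n)) \<longlonglongrightarrow> d"
      using tendsto_add[OF tendsto_const[of d] LIMSEQ_inverse_real_of_nat] by (simp add: inverse_eq_divide)
  qed (use s(2) less_imp_le in blast)
  have "ip (x - y) z = 0" if "z \<in> S" for z
  proof (cases "z = 0")
    case False
    define c where "c = ip (x - y) z / of_real ((norm z)\<^sup>2)"
    have "y + smul c z \<in> S"
      using \<open>y \<in> S\<close> that by (intro subspace_add subspace_scale S)
    then have "d \<le> (norm (x - y - smul c z))\<^sup>2"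
      using d_le[of "y + smul c z"] by (simp add: diff_diff_eq)
    also have "\<dots> = (norm (x - y))\<^sup>2 - (norm (ip (x - y) z))\<^sup>2 / (norm z)\<^sup>2"
      unfolding c_def by (rule norm_sub_component[OF False])
    finally have "(norm (ip (x - y) z))\<^sup>2 / (norm z)\<^sup>2 \<le> 0"
      using \<open>(norm (x - y))\<^sup>2 \<le> d\<close> by simp
    then show ?thesis using False by (simp add: divide_le_0_iff)
  qed simp
  then show ?thesis using \<open>y \<in> S\<close> by blast
qed

lemma orth_proj:
  assumes S: "subspace S" "closed S"
  shows "orth_proj ip S x \<in> S" and "z \<in> S \<Longrightarrow> ip (x - orth_proj ip S x) z = 0"
proof -
  obtain y where y: "y \<in> S" "\<And>z. z \<in> S \<Longrightarrow> ip (x - y) z = 0"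
    using orth_proj_exists[OF S] by blast
  have "orth_proj ip S x = y"
    unfolding orth_proj_def
  proof (rule the_equality)
    fix y' assume y': "y' \<in> S \<and> (\<forall>z\<in>S. ip (x - y') z = 0)"
    then have "y' - y \<in> S" using y by (intro subspace_diff S) auto
    then have "ip (x - y) (y' - y) - ip (x - y') (y' - y) = 0" using y y' by simp
    then have "ip (y' - y) (y' - y) = 0" by (simp flip: ip_diff_left)
    then show "y' = y" by (simp add: ip_self)
  qed (use y in auto)
  then show "orth_proj ip S x \<in> S" and "z \<in> S \<Longrightarrow> ip (x - orth_proj ip S x) z = 0"
    using y by auto
qed

text \<open>
  Pythagoras together with Bessel's inequality. The second hypothesis says that \<open>e n\<close> is the
  component of \<open>f\<close> in its own direction.
\<close>

lemma orthogonal_sum_norm_le: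
  assumes orth: "\<And>m n. m \<noteq> n \<Longrightarrow> ip (e m) (e n) = 0"
    and proj: "\<And>n. ip (f - e n) (e n) = 0"
    and c: "\<And>n. norm (c n) \<le> B"
  shows "norm (\<Sum>n<N::nat. smul (c n) (e n)) \<le> B * norm f"
proof -
  have sq: "(norm (\<Sum>n<N. smul (a n) (e n)))\<^sup>2 = (\<Sum>n<N. (norm (a n))\<^sup>2 * (norm (e n))\<^sup>2)" for a and N :: nat
  proof (induction N)
    case (Suc N)
    have "ip (\<Sum>n<N. smul (a n) (e n)) (smul (a N) (e N)) = 0"
      by (simp add: ip_sum_left ip_smul_left ip_smul_right orth)
    from pythagoras[OF this] show ?case
      using Suc by (simp add: norm_smul power_mult_distrib)
  qed simp
  have B: "0 \<le> B" using c[of 0] norm_ge_zero order_trans by blast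
  \<comment> \<open>Bessel: \<open>E\<close> is the orthogonal projection of \<open>f\<close> onto the span of the \<open>e n\<close>.\<close>
  define E where "E = (\<Sum>n<N. e n)"
  have "ip (f - E) (e m) = 0" if "m < N" for m
  proof -
    have "ip E (e m) = (\<Sum>n<N. if n = m then ip (e m) (e m) else 0)"
      unfolding E_def ip_sum_left by (intro sum.cong) (auto simp: orth)
    also have "\<dots> = ip (e m) (e m)" using that by simp
    finally show ?thesis using proj[of m] by (simp add: ip_diff_left)
  qed
  then have "ip (f - E) E = 0"
    unfolding E_def ip_sum_right by (intro sum.neutral) auto
  from pythagoras[OF this] have "(norm f)\<^sup>2 = (norm (f - E))\<^sup>2 + (norm E)\<^sup>2" by simp
  moreover have "(norm E)\<^sup>2 = (\<Sum>n<N. (norm (e n))\<^sup>2)"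
    using sq[of "\<lambda>_. 1" N] by (simp add: E_def)
  ultimately have bessel: "(\<Sum>n<N. (norm (e n))\<^sup>2) \<le> (norm f)\<^sup>2" by simp
  have "(norm (\<Sum>n<N. smul (c n) (e n)))\<^sup>2 \<le> (\<Sum>n<N. B\<^sup>2 * (norm (e n))\<^sup>2)"
    unfolding sq using c by (intro sum_mono mult_right_mono power_mono) auto
  also have "\<dots> \<le> B\<^sup>2 * (norm f)\<^sup>2"
    unfolding sum_distrib_left[symmetric] using bessel by (rule mult_left_mono) simp
  finally have "(norm (\<Sum>n<N. smul (c n) (e n)))\<^sup>2 \<le> (B * norm f)\<^sup>2"
    by (simp add: power_mult_distrib)
  then show ?thesis by (rule power2_le_imp_le) (use B in simp)
qed

lemma self_adjoint_symmetric:
  assumes "self_adjoint ip D A" "x \<in> D" "y \<in> D"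
  shows "ip (A x) y = ip x (A y)"
proof -
  have "(y, A y) \<in> adjoint_graph ip D A"
    using assms unfolding self_adjoint_def by auto
  then show ?thesis using assms(2) by (simp add: adjoint_graph_def)
qed

text \<open>
  Self-adjointness turns membership of \<open>y\<close>, including \<open>y \<in> D\<close>, into a family of continuous
  conditions on \<open>y\<close>; closedness can then be read off although \<open>A\<close> is unbounded.
\<close>

lemma eigenspace_self_adjoint:
  assumes sa: "self_adjoint ip D A"
  shows "eigenspace smul D (\<lambda>x. - A x) (of_real l) = {y. \<forall>x\<in>D. ip (A x) y = - (l *\<^sub>R ip x y)}"
proof (intro equalityI subsetI CollectI ballI)
  fix x y assume y: "y \<in> eigenspace smul D (\<lambda>x. - A x) (of_real l)" and x: "x \<in> D"
  then have "A y = - (l *\<^sub>R y)" "y \<in> D" by (auto simp: eigenspace_def smul_of_real) (metis minus_minus)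
  then show "ip (A x) y = - (l *\<^sub>R ip x y)"
    using self_adjoint_symmetric[OF sa x, of y] by (simp add: ip_minus_right ip_scaleR_right)
next
  fix y assume "y \<in> {y. \<forall>x\<in>D. ip (A x) y = - (l *\<^sub>R ip x y)}"
  then have "(y, - (l *\<^sub>R y)) \<in> adjoint_graph ip D A"
    by (auto simp: adjoint_graph_def ip_minus_right ip_scaleR_right)
  then show "y \<in> eigenspace smul D (\<lambda>x. - A x) (of_real l)"
    using sa by (auto simp: self_adjoint_def eigenspace_def smul_of_real minus_equation_iff)
qed

lemma closed_eigenspace:
  assumes "self_adjoint ip D A"
  shows "closed (eigenspace smul D (\<lambda>x. - A x) (of_real l))"
proof -
  have "closed {y. ip (A x) y = - (l *\<^sub>R ip x y)}" for x
    by (intro closed_Collect_eq continuous_intros bounded_linear.continuous_on[OF bounded_linear_ip_right])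
  then have "closed (\<Inter>x\<in>D. {y. ip (A x) y = - (l *\<^sub>R ip x y)})"
    by (intro closed_INT) auto
  also have "(\<Inter>x\<in>D. {y. ip (A x) y = - (l *\<^sub>R ip x y)}) = eigenspace smul D (\<lambda>x. - A x) (of_real l)"
    unfolding eigenspace_self_adjoint[OF assms] by auto
  finally show ?thesis .
qed

lemma subspace_eigenspace:
  assumes "self_adjoint ip D A"
  shows "subspace (eigenspace smul D (\<lambda>x. - A x) (of_real l))"
  unfolding eigenspace_self_adjoint[OF assms] subspace_def
  by (auto simp: ip_add_right ip_smul_right scaleR_add_right)

lemma eigenspace_orthogonal:
  assumes sa: "self_adjoint ip D A" and "l \<noteq> m"
    and x: "x \<in> eigenspace smul D (\<lambda>x. - A x) (of_real l)"
    and y: "y \<in> eigenspace smul D (\<lambda>x. - A x) (of_real m)"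
  shows "ip x y = 0"
proof -
  have x': "x \<in> D" "A x = - (l *\<^sub>R x)"
    using x by (auto simp: eigenspace_def smul_of_real) (metis minus_minus)
  have "ip (A x) y = - (m *\<^sub>R ip x y)"
    using y x'(1) unfolding eigenspace_self_adjoint[OF sa] by blast
  then have "(l - m) *\<^sub>R ip x y = 0"
    unfolding x'(2) by (simp add: ip_minus_left ip_scaleR_left scaleR_left_diff_distrib)
  then show ?thesis using \<open>l \<noteq> m\<close> by simp
qed

lemma eigenvalue_pos:
  assumes "bounded_below_by ip D (\<lambda>x. - A x) c" "c > 0"
    and "of_real l \<in> eigenvalues smul D (\<lambda>x. - A x)"
  shows "l > 0"
proof -
  obtain x where x: "x \<in> D" "- A x = l *\<^sub>R x" "x \<noteq> 0"
    using assms(3) by (auto simp: eigenvalues_def eigenspace_def smul_of_real)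
  have "c * (norm x)\<^sup>2 \<le> sre (ip (l *\<^sub>R x) x)"
    using assms(1) x unfolding bounded_below_by_def by metis
  also have "ip (l *\<^sub>R x) x = of_real (l * (norm x)\<^sup>2)"
    by (simp add: ip_scaleR_left ip_self scaleR_conv_of_real)
  finally have "c * (norm x)\<^sup>2 \<le> l * (norm x)\<^sup>2" by (simp only: sre_of_real)
  then show ?thesis using x assms(2) by simp
qed

lemma spectral_proj_sum_norm_le:
  assumes sa: "self_adjoint ip D A" and lam: "strict_mono (lam :: nat \<Rightarrow> real)" and c: "\<And>n. norm (c n) \<le> B"
  shows "norm (\<Sum>n<N. smul (c n) (spectral_proj smul ip D A lam n f)) \<le> B * norm f"
proof (rule orthogonal_sum_norm_le[OF _ _ c])
  note P = orth_proj[OF subspace_eigenspace[OF sa] closed_eigenspace[OF sa]]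
  show "ip (spectral_proj smul ip D A lam m f) (spectral_proj smul ip D A lam n f) = 0" if "m \<noteq> n" for m n
    unfolding spectral_proj_def
    using that strict_mono_eq[OF lam, of m n]
    by (intro eigenspace_orthogonal[OF sa, of "lam m" "lam n"] P(1)) auto
  show "ip (f - spectral_proj smul ip D A lam n f) (spectral_proj smul ip D A lam n f) = 0" for n
    unfolding spectral_proj_def by (intro P)
qed

end

section \<open>Pointwise bounds for the solution\<close>

lemma admissible_profiles_bounds:
  fixes p :: "real \<Rightarrow> 'k::real_normed_vector"
  assumes p: "p \<in> admissible_profiles T p0 M" and T: "T > 0"
  shows "continuous_on {0..T} p"
    and "t \<in> {0..T} \<Longrightarrow> norm (p t) \<le> M"
    and "t \<in> {0..T} \<Longrightarrow> norm (p t - p0) \<le> M * t"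
proof -
  let ?d = "\<lambda>t. vector_derivative p (at t within {0..T})"
  have diff: "p differentiable (at t within {0..T})" if "t \<in> {0..T}" for t
    using p that by (auto simp: admissible_profiles_def C1_on_def)
  have dcont: "continuous_on {0..T} ?d" and p0: "p 0 = p0" and le: "C1_norm T p \<le> M"
    using p by (auto simp: admissible_profiles_def C1_on_def)
  show cont: "continuous_on {0..T} p"
    using diff by (simp add: continuous_on_eq_continuous_within differentiable_imp_continuous_within)
  have bdd: "bdd_above ((\<lambda>t. norm (q t)) ` {0..T})" if "continuous_on {0..T} q" for q :: "real \<Rightarrow> 'k"
    by (intro bounded_imp_bdd_above compact_imp_bounded compact_continuous_image continuous_on_norm that) auto
  have S1: "norm (p t) \<le> (SUP t\<in>{0..T}. norm (p t))" and S2: "norm (?d t) \<le> (SUP t\<in>{0..T}. norm (?d t))"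
    if "t \<in> {0..T}" for t
    using that cont dcont by (auto intro!: cSUP_upper bdd)
  have "0 \<in> {0..T}" using T by simp
  then have "0 \<le> (SUP t\<in>{0..T}. norm (p t))" "0 \<le> (SUP t\<in>{0..T}. norm (?d t))"
    using S1[of 0] S2[of 0] norm_ge_zero order_trans by blast+
  then have B: "norm (p t) \<le> M" "norm (?d t) \<le> M" if "t \<in> {0..T}" for t
    using S1[OF that] S2[OF that] le unfolding C1_norm_def by linarith+
  show "t \<in> {0..T} \<Longrightarrow> norm (p t) \<le> M" by (rule B)
  show "norm (p t - p0) \<le> M * t" if t: "t \<in> {0..T}"
  proof -
    have "norm (p t - p 0) \<le> M * norm (t - 0)"
    proof (rule differentiable_bound[of "{0..T}" p "\<lambda>t h. h *\<^sub>R ?d t"])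
      show "(p has_derivative (\<lambda>h. h *\<^sub>R ?d s)) (at s within {0..T})" if "s \<in> {0..T}" for s
        using diff[OF that] by (simp add: vector_derivative_works flip: has_vector_derivative_def)
      show "onorm (\<lambda>h. h *\<^sub>R ?d s) \<le> M" if "s \<in> {0..T}" for s
        proof (rule onorm_bound)
        show "norm (h *\<^sub>R ?d s) \<le> M * norm h" for h
          using mult_right_mono[OF B(2)[OF that], of "\<bar>h\<bar>"] by (simp add: mult.commute)
        show "0 \<le> M" using B(2)[OF that] norm_ge_zero order_trans by blast
      qed
    qed (use t T in auto)
    then show ?thesis using t by (simp add: p0)
  qed
qed

text \<open>
  This keeps the final constant independent of \<open>\<alpha>\<close>: the Gamma values in the denominators have
  arguments between 1 and 2.
\<close>

lemma Gamma_lower_bound: "\<exists>c>0. \<forall>x\<in>{1..2::real}. c \<le> Gamma x"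
proof -
  have "continuous_on {1..2} (Gamma :: real \<Rightarrow> real)"
    by (intro continuous_on_Gamma continuous_on_id) (auto elim!: nonpos_Ints_cases)
  then obtain x :: real where "x \<in> {1..2}" "\<forall>y\<in>{1..2}. Gamma x \<le> Gamma y"
    using continuous_attains_inf[of "{1..2::real}" Gamma] by auto
  then show ?thesis by (intro exI[of _ "Gamma x"]) auto
qed

text \<open>
  The bounds on the Mittag--Leffler kernel replace it by the Riemann--Liouville kernel, and \<open>n\<close> no
  longer enters the estimate.
\<close>

lemma (in hilbert_space) series_term_eq:
  assumes a: "0 < a" "a < 1" and lam: "0 < lam n" and t: "0 < t" "t \<le> T"
    and p: "continuous_on {0..T} p" and M: "\<And>s. s \<in> {0..T} \<Longrightarrow> norm (p s) \<le> M"
  shows "\<exists>c. norm c \<le> M * frac_kern (a + 1) t \<and>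
    series_term smul ip D A lam f p a n t = smul c (spectral_proj smul ip D A lam n f)"
proof -
  let ?M = "lebesgue_on {0<..<t}" and ?e = "ml_kern a (lam n)"
  define c where "c = (LINT s|?M. of_real (?e (t - s)) * p s)"
  have [measurable]: "p \<in> borel_measurable ?M"
    using t by (intro continuous_imp_measurable_on_sets_lebesgue continuous_on_subset[OF p]) auto
  have K: "has_bochner_integral ?M (\<lambda>s. M * frac_kern a (t - s)) (M * frac_kern (a + 1) t)"
    using a t by (intro has_bochner_integral_mult_right frac_kern_integral) auto
  have bound: "norm (of_real (?e (t - s)) * p s) \<le> M * frac_kern a (t - s)" if "s \<in> space ?M" for s
  proof -
    have "norm (of_real (?e (t - s)) * p s) = ?e (t - s) * norm (p s)"
      using ml_kern_bounds(1)[OF a lam] by (simp add: norm_mult)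
    also have "\<dots> \<le> frac_kern a (t - s) * M"
      using that t a by (intro mult_mono ml_kern_bounds a lam M) (auto simp: frac_kern_nonneg)
    finally show ?thesis by (simp add: mult.commute)
  qed
  have int: "integrable ?M (\<lambda>s. of_real (?e (t - s)) * p s)"
  proof (rule Bochner_Integration.integrable_bound)
    show "integrable ?M (\<lambda>s. M * frac_kern a (t - s))"
      using K by (simp add: has_bochner_integral_iff)
    show "(\<lambda>s. of_real (?e (t - s)) * p s) \<in> borel_measurable ?M"
      by measurable
    show "AE s in ?M. norm (of_real (?e (t - s)) * p s) \<le> norm (M * frac_kern a (t - s))"
      using bound by (intro AE_I2) (force simp: real_norm_def)
  qed
  have "norm c \<le> (LINT s|?M. M * frac_kern a (t - s))"
    unfolding c_def using K int bound
    by (intro Bochner_Integration.integral_norm_bound_integral) (auto simp: has_bochner_integral_iff)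
  then have "norm c \<le> M * frac_kern (a + 1) t"
    unfolding has_bochner_integral_integral_eq[OF K] .
  moreover have "series_term smul ip D A lam f p a n t
      = (LINT s|?M. smul (of_real (?e (t - s)) * p s) (spectral_proj smul ip D A lam n f))"
    unfolding series_term_def
    by (intro Bochner_Integration.integral_cong) (auto simp: ml_kern_eq[OF a])
  moreover have "\<dots> = smul c (spectral_proj smul ip D A lam n f)"
    unfolding c_def by (rule integral_bounded_linear[OF bounded_linear_smul_left int])
  ultimately show ?thesis by auto
qed

text \<open>
  The excess of \<open>\<parallel>w(t)\<parallel>\<close> over \<open>b(t)\<close> is at most \<open>\<parallel>W N t - w t\<parallel>\<close>, whose square has an
  integral that tends to 0 with growing \<open>N\<close>; so the excess vanishes almost everywhere.
\<close>

lemma L2_tendsto_norm_le: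
  assumes lim: "L2_tendsto T W w" and bound: "\<And>N t. t \<in> {0<..<T} \<Longrightarrow> norm (W N t) \<le> b t"
    and b [measurable]: "b \<in> borel_measurable (lebesgue_on {0<..<T})"
  shows "AE t in lebesgue_on {0<..<T}. norm (w t) \<le> b t"
proof -
  let ?M = "lebesgue_on {0<..<T}"
  define \<phi> where "\<phi> = (\<lambda>t. (max 0 (norm (w t) - b t))\<^sup>2)"
  have [measurable]: "w \<in> borel_measurable ?M" "\<And>N. W N \<in> borel_measurable ?M"
    and iw: "integrable ?M (\<lambda>t. (norm (w t))\<^sup>2)" and iW: "\<And>N. integrable ?M (\<lambda>t. (norm (W N t))\<^sup>2)"
    and lim0: "(\<lambda>N. LINT t|?M. (norm (W N t - w t))\<^sup>2) \<longlonglongrightarrow> 0"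
    using lim by (auto simp: L2_tendsto_def L2_def)
  have id: "integrable ?M (\<lambda>t. (norm (W N t - w t))\<^sup>2)" for N
  proof (rule Bochner_Integration.integrable_bound)
    show "integrable ?M (\<lambda>t. 2 * (norm (W N t))\<^sup>2 + 2 * (norm (w t))\<^sup>2)"
      using iw iW by auto
    have "(norm (x - y))\<^sup>2 \<le> 2 * (norm x)\<^sup>2 + 2 * (norm y)\<^sup>2" for x y :: 'a
    proof -
      have "(norm (x - y))\<^sup>2 \<le> (norm x + norm y)\<^sup>2" by (intro power_mono norm_triangle_ineq4) auto
      also have "\<dots> \<le> 2 * (norm x)\<^sup>2 + 2 * (norm y)\<^sup>2"
        using sum_squares_bound[of "norm x" "norm y"] by (simp add: power2_sum)
      finally show ?thesis .
    qed
    then show "AE t in ?M. norm ((norm (W N t - w t))\<^sup>2) \<le> norm (2 * (norm (W N t))\<^sup>2 + 2 * (norm (w t))\<^sup>2)"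
      by (intro AE_I2) simp
  qed measurable
  have le: "\<phi> t \<le> (norm (W N t - w t))\<^sup>2" if "t \<in> space ?M" for N t
  proof -
    have "norm (w t) - b t \<le> norm (W N t - w t)"
      using that bound[of t N] norm_triangle_ineq3[of "w t" "W N t"] by (auto simp: norm_minus_commute)
    then show ?thesis unfolding \<phi>_def by (intro power_mono) auto
  qed
  have i\<phi>: "integrable ?M \<phi>"
  proof (rule Bochner_Integration.integrable_bound[OF id[of 0]])
    show "\<phi> \<in> borel_measurable ?M" unfolding \<phi>_def by measurable
    show "AE t in ?M. norm (\<phi> t) \<le> norm ((norm (W 0 t - w t))\<^sup>2)"
      using le[of _ 0] by (intro AE_I2) (auto simp: \<phi>_def)
  qed
  have "(LINT t|?M. \<phi> t) \<le> 0"
    using lim0 by (rule LIMSEQ_le_const) (use i\<phi> id le in \<open>auto intro!: exI[of _ 0] integral_mono\<close>)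
  moreover have "0 \<le> (LINT t|?M. \<phi> t)"
    by (intro Bochner_Integration.integral_nonneg) (auto simp: \<phi>_def)
  ultimately have "(LINT t|?M. \<phi> t) = 0" by linarith
  moreover have "AE t in ?M. 0 \<le> \<phi> t" by (simp add: \<phi>_def)
  ultimately have "AE t in ?M. \<phi> t = 0"
    using integral_nonneg_eq_0_iff_AE[OF i\<phi>] by blast
  then show ?thesis
    by eventually_elim (auto simp: \<phi>_def max_def split: if_splits)
qed

text \<open>
  The partial sums satisfy the bound by orthogonality, and it survives the limit in \<open>L\<^sup>2\<close>.
\<close>

lemma (in hilbert_space) series_sum_norm_le:
  assumes sa: "self_adjoint ip D A" and lam: "strict_mono lam" and lam_pos: "\<And>n. 0 < lam n"
    and a: "0 < a" "a < 1"
    and p: "continuous_on {0..T} p" and M: "\<And>s. s \<in> {0..T} \<Longrightarrow> norm (p s) \<le> M"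
    and u: "is_series_sum D A T a (series_term smul ip D A lam f p a) u"
  shows "AE t in lebesgue_on {0<..<T}. norm (u t) \<le> M * norm f * frac_kern (a + 1) t"
proof (rule L2_tendsto_norm_le)
  show "L2_tendsto T (\<lambda>N t. \<Sum>n<N. series_term smul ip D A lam f p a n t) u"
    using u by (simp add: is_series_sum_def Let_def)
  show "(\<lambda>t. M * norm f * frac_kern (a + 1) t) \<in> borel_measurable (lebesgue_on {0<..<T})"
    by measurable
  show "norm (\<Sum>n<N. series_term smul ip D A lam f p a n t) \<le> M * norm f * frac_kern (a + 1) t"
    if "t \<in> {0<..<T}" for N t
  proof -
    have "\<exists>c. norm c \<le> M * frac_kern (a + 1) t \<and>
        series_term smul ip D A lam f p a n t = smul c (spectral_proj smul ip D A lam n f)" for n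
      using that by (intro series_term_eq[where T = T] a lam_pos p M) auto
    then obtain c where c: "\<And>n. norm (c n) \<le> M * frac_kern (a + 1) t"
      "\<And>n. series_term smul ip D A lam f p a n t = smul (c n) (spectral_proj smul ip D A lam n f)"
      by metis
    show ?thesis
      using spectral_proj_sum_norm_le[OF sa lam c(1), where N = N and f = f] by (simp add: c(2) mult_ac)
  qed
qed

lemma L2_integrable:
  assumes "L2 T w"
  shows "integrable (lebesgue_on {0<..<T}) w"
proof (rule Bochner_Integration.integrable_bound)
  interpret finite_measure "lebesgue_on {0<..<T}"
    by (rule finite_measure_lebesgue_on)
  show "integrable (lebesgue_on {0<..<T}) (\<lambda>t. 1 + (norm (w t))\<^sup>2)"
    using assms by (auto simp: L2_def)
  have "x \<le> 1 + x\<^sup>2" for x :: real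
    using zero_le_power2[of "x - 1 / 2"] by (simp add: power2_eq_square algebra_simps)
  then show "AE t in lebesgue_on {0<..<T}. norm (w t) \<le> norm (1 + (norm (w t))\<^sup>2)"
    by (intro AE_I2) simp
qed (use assms in \<open>simp add: L2_def\<close>)

lemma L2_continuous:
  fixes g :: "real \<Rightarrow> 'x::{banach,second_countable_topology}"
  assumes g: "continuous_on {0..T} g"
  shows "L2 T g"
  unfolding L2_def
proof
  interpret finite_measure "lebesgue_on {0<..<T}"
    by (rule finite_measure_lebesgue_on)
  show m [measurable]: "g \<in> borel_measurable (lebesgue_on {0<..<T})"
    by (intro continuous_imp_measurable_on_sets_lebesgue continuous_on_subset[OF g]) auto
  have "bounded (g ` {0..T})"
    by (intro compact_imp_bounded compact_continuous_image g) auto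
  then obtain B where B: "\<forall>x\<in>g ` {0..T}. norm x \<le> B"
    unfolding bounded_iff by blast
  show "integrable (lebesgue_on {0<..<T}) (\<lambda>t. (norm (g t))\<^sup>2)"
    by (rule integrable_const_bound[of _ "B\<^sup>2"]) (use B in \<open>auto intro!: AE_I2 power_mono\<close>)
qed

section \<open>The fractional derivative of the observation\<close>

lemma has_cont_frac_deriv_frac_integral:
  fixes h :: "real \<Rightarrow> 'x::{banach,second_countable_topology}"
  assumes \<gamma>: "0 \<le> \<gamma>" "\<gamma> < a" and a: "a < 1"
    and h: "h \<in> borel_measurable (lebesgue_on {0<..<T})"
    and B: "AE s in lebesgue_on {0<..<T}. norm (h s) \<le> B"
    and v: "AE t in lebesgue_on {0<..<T}. v t = frac_integral a h t"
  shows "has_cont_frac_deriv T \<gamma> v (frac_integral (a - \<gamma>) h)"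
proof -
  have cont: "continuous_on {0..T} (frac_integral (a - \<gamma>) h)"
    using \<gamma> a by (intro continuous_on_frac_integral[OF _ _ h B]) auto
  have "frac_integral \<gamma> (frac_integral (a - \<gamma>) h) t = frac_integral a h t" if t: "t \<in> {0<..<T}" for t
  proof (cases "\<gamma> = 0")
    case True
    then show ?thesis by (simp add: frac_integral_def)
  next
    case False
    have "frac_integral \<gamma> (frac_integral (a - \<gamma>) h) t = frac_integral (\<gamma> + (a - \<gamma>)) h t"
      using \<gamma> False t B
      by (intro frac_integral_semigroup[of _ _ _ T] frac_kern_scaleR_integrable[of _ _ _ _ B] h) auto
    then show ?thesis by simp
  qed
  then have "AE t in lebesgue_on {0<..<T}. frac_integral \<gamma> (frac_integral (a - \<gamma>) h) t = frac_integral a h t"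
    by (intro AE_I2) auto
  with v have "AE t in lebesgue_on {0<..<T}. v t = frac_integral \<gamma> (frac_integral (a - \<gamma>) h) t"
    by eventually_elim simp
  then show ?thesis
    using cont by (simp add: has_cont_frac_deriv_def has_frac_deriv_def L2_continuous)
qed

text \<open>
  Only almost everywhere: at a point \<open>t\<close> where the vector-valued integrand is not integrable, the left
  integral has the default value 0, while the right one need not vanish.
\<close>

lemma frac_integral_bounded_linear:
  fixes w :: "real \<Rightarrow> 'x::{banach,second_countable_topology}"
    and L :: "'x \<Rightarrow> 'y::{banach,second_countable_topology}"
  assumes L: "bounded_linear L" and a: "a > 0" and w: "L2 T w"
  shows "AE t in lebesgue_on {0<..<T}. L (frac_integral a w t) = frac_integral a (\<lambda>s. L (w s)) t"
proof -
  have "AE t in lebesgue_on {0<..<T}. t \<in> {0<..<T}" by (intro AE_I2) auto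
  then show ?thesis
    using AE_integrable_kern[OF a L2_integrable[OF w]]
  proof eventually_elim
    case (elim t)
    then show ?case
      using a integral_bounded_linear[OF L elim(2)]
      by (simp add: frac_integral_kern[of _ _ T] linear_scale[OF bounded_linear.linear[OF L]])
  qed
qed

lemma (in hilbert_space) observation_density:
  assumes sa: "self_adjoint ip D A" and \<psi>: "\<psi> \<in> D"
    and D: "AE t in lebesgue_on {0<..<T}. u t \<in> D"
    and w: "AE t in lebesgue_on {0<..<T}. w t = A (u t) + smul (p t) f"
  shows "AE t in lebesgue_on {0<..<T}. ip (w t) \<psi> = ip (u t) (A \<psi>) + p t * ip f \<psi>"
  using D w
  by eventually_elim (simp add: ip_add_left ip_smul_left self_adjoint_symmetric[OF sa _ \<psi>])

theorem proposition3p1: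
  fixes smul :: "'k::real_or_complex \<Rightarrow> 'x::{banach,second_countable_topology} \<Rightarrow> 'x"
    and ip :: "'x \<Rightarrow> 'x \<Rightarrow> 'k"
    and D :: "'x set" and A :: "'x \<Rightarrow> 'x"
    and lam :: "nat \<Rightarrow> real"
    and T \<alpha>\<^sub>m \<alpha>\<^sub>p M \<gamma> :: real
    and p0 :: 'k and f \<psi> :: 'x
  assumes "hilbert_space smul ip"
    and "linear_operator smul D A"
    and "densely_defined D"
    and "self_adjoint ip D A"
    and "\<exists>c>0. bounded_below_by ip D (\<lambda>x. - A x) c"
    and "compact_resolvent smul D A"
    and "eigenvalue_enumeration smul D A lam"
    and "T > 0"
    and "0 < \<alpha>\<^sub>m" and "\<alpha>\<^sub>m < \<alpha>\<^sub>p" and "\<alpha>\<^sub>p < 1"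
    and "p0 \<noteq> 0" and "M > norm p0"
    and "\<psi> \<in> D"
    and "p0 * ip f \<psi> \<noteq> 0"
    and "0 \<le> \<gamma>" and "\<gamma> < \<alpha>\<^sub>m"
  shows "\<exists>t1 C. 0 < t1 \<and> t1 \<le> min 1 T \<and> 0 < C \<and>
    (\<forall>p\<in>admissible_profiles T p0 M. \<forall>\<alpha>\<in>{\<alpha>\<^sub>m..\<alpha>\<^sub>p}. \<forall>u.
       is_solution smul ip D A lam T f p \<alpha> u \<longrightarrow>
       (\<exists>g. has_cont_frac_deriv T \<gamma> (\<lambda>t. ip (u t) \<psi>) g \<and>
          (\<forall>t\<in>{0<..t1}.
             norm (g t - p0 * ip f \<psi> * of_real (t powr (\<alpha> - \<gamma>) / Gamma (1 + \<alpha> - \<gamma>)))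
               \<le> C * t powr (2 * \<alpha> - \<gamma>))))"
proof -
  interpret hilbert_space smul ip by fact
  note sa = \<open>self_adjoint ip D A\<close>
  have lam: "strict_mono lam" "0 < lam n" for n
  proof -
    show "strict_mono lam"
      using assms(7) by (simp add: eigenvalue_enumeration_def)
    have "of_real (lam n) \<in> eigenvalues smul D (\<lambda>x. - A x)"
      using assms(7) unfolding eigenvalue_enumeration_def by (metis rangeI)
    then show "0 < lam n"
      using assms(5) eigenvalue_pos by blast
  qed
  obtain c where c: "c > 0" "\<And>x. x \<in> {1..2} \<Longrightarrow> c \<le> Gamma (x::real)"
    using Gamma_lower_bound by blast
  have frac_kern_le: "frac_kern (a + 1) t \<le> t powr a / c" if "0 \<le> a" "a \<le> 1" for a t
    using that c by (auto simp: frac_kern_def intro!: divide_left_mono mult_pos_pos)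
  \<comment> \<open>\<open>K t\<^sup>\<alpha>\<close> will bound the deviation of \<open>h(t)\<close> from \<open>p0 (f, \<psi>)\<close> for \<open>t \<le> 1\<close>: \<open>N\<close> comes from \<open>u\<close>, the other summand from \<open>p\<close>.\<close>
  define N where "N = M * norm f * norm (A \<psi>)"
  define K where "K = N / c + M * norm (ip f \<psi>)"
  have M: "0 \<le> M" using \<open>M > norm p0\<close> norm_ge_zero[of p0] by linarith
  have "0 \<le> K" "0 \<le> N" using M c by (auto simp: K_def N_def)
  have main: "\<exists>g. has_cont_frac_deriv T \<gamma> (\<lambda>t. ip (u t) \<psi>) g \<and>
          (\<forall>t\<in>{0<..min 1 T}.
             norm (g t - p0 * ip f \<psi> * of_real (t powr (a - \<gamma>) / Gamma (1 + a - \<gamma>)))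
               \<le> (K / c + 1) * t powr (2 * a - \<gamma>))"
    if p: "p \<in> admissible_profiles T p0 M" and "a \<in> {\<alpha>\<^sub>m..\<alpha>\<^sub>p}"
      and sol: "is_solution smul ip D A lam T f p a u" for p a u
  proof -
    let ?M = "lebesgue_on {0<..<T}"
    have a: "0 < a" "a < 1" "\<gamma> < a" using \<open>a \<in> {\<alpha>\<^sub>m..\<alpha>\<^sub>p}\<close> assms by auto
    note pb = admissible_profiles_bounds[OF p \<open>T > 0\<close>]
    have AEin: "AE t in ?M. t \<in> {0<..<T}" by (intro AE_I2) auto
    obtain w where w: "has_frac_deriv T a u w" "AE t in ?M. w t = A (u t) + smul (p t) f"
      and uD: "AE t in ?M. u t \<in> D"
      using sol by (auto simp: is_solution_def solves_fde_def)
    have w2: "L2 T w" and uw: "AE t in ?M. u t = frac_integral a w t"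
      using w(1) by (auto simp: has_frac_deriv_def)
    define h where "h = (\<lambda>s. ip (w s) \<psi>)"
    have [measurable]: "w \<in> borel_measurable ?M" using w2 by (simp add: L2_def)
    have hm [measurable]: "h \<in> borel_measurable ?M"
      unfolding h_def
      by (rule measurable_compose[OF _ borel_measurable_continuous_onI])
        (auto intro: bounded_linear.continuous_on[OF bounded_linear_ip_left])
    have h_dev: "AE s in ?M. norm (h s - p0 * ip f \<psi>) \<le> N * frac_kern (a + 1) s + M * s * norm (ip f \<psi>)"
    proof -
      have "AE s in ?M. norm (u s) \<le> M * norm f * frac_kern (a + 1) s"
        using sol by (intro series_sum_norm_le[OF sa lam a(1,2) pb(1,2)]) (auto simp: is_solution_def)
      then show ?thesis
        using AEin observation_density[OF sa \<open>\<psi> \<in> D\<close> uD w(2)]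
      proof eventually_elim
        case (elim s)
        have "norm (h s - p0 * ip f \<psi>) = norm (ip (u s) (A \<psi>) + (p s - p0) * ip f \<psi>)"
          using elim(3) by (simp add: h_def algebra_simps)
        also have "\<dots> \<le> norm (ip (u s) (A \<psi>)) + norm (p s - p0) * norm (ip f \<psi>)"
          by (metis norm_triangle_ineq norm_mult)
        also have "\<dots> \<le> norm (u s) * norm (A \<psi>) + (M * s) * norm (ip f \<psi>)"
          using elim(2) pb(3)[of s] by (intro add_mono mult_right_mono cauchy_schwarz) auto
        also have "norm (u s) * norm (A \<psi>) \<le> (M * norm f * frac_kern (a + 1) s) * norm (A \<psi>)"
          using elim(1) by (rule mult_right_mono) simp
        finally show ?case by (simp add: N_def mult_ac)
      qed
    qed
    have h_le: "AE s in ?M. s < t \<longrightarrow> norm (h s - p0 * ip f \<psi>) \<le> K * t powr a" if t: "t \<in> {0<..min 1 T}" for t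
      using h_dev AEin
    proof eventually_elim
      case (elim s)
      have "N * frac_kern (a + 1) s + M * s * norm (ip f \<psi>) \<le> K * t powr a" if "s < t"
      proof -
        have st: "s powr a \<le> t powr a" using that elim(2) a by (intro powr_mono2) auto
        \<comment> \<open>This is where \<open>t \<le> 1\<close> enters: \<open>p(s) - p0\<close> is \<open>O(s)\<close>, which is absorbed into \<open>s\<^sup>a\<close>.\<close>
        have "s powr 1 \<le> s powr a"
          using that elim(2) a t by (intro powr_mono') auto
        then have "s \<le> t powr a" using elim(2) st by simp
        moreover have "frac_kern (a + 1) s \<le> t powr a / c"
          using order_trans[OF frac_kern_le[of a s] divide_right_mono[OF st]] a c by simp
        ultimately have "N * frac_kern (a + 1) s + M * norm (ip f \<psi>) * s \<le> N * (t powr a / c) + M * norm (ip f \<psi>) * t powr a"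
          using M \<open>0 \<le> N\<close> by (intro add_mono mult_left_mono) auto
        then show ?thesis by (simp add: K_def algebra_simps)
      qed
      then show ?case using elim(1) by auto
    qed
    have h_bound: "AE s in ?M. norm (h s) \<le> norm (p0 * ip f \<psi>) + (N * (T powr a / c) + M * T * norm (ip f \<psi>))"
      using h_dev AEin
    proof eventually_elim
      case (elim s)
      have sT: "s powr a \<le> T powr a" using elim(2) a by (intro powr_mono2) auto
      have "frac_kern (a + 1) s \<le> T powr a / c"
        using order_trans[OF frac_kern_le[of a s] divide_right_mono[OF sT]] a c by simp
      then have "N * frac_kern (a + 1) s + M * s * norm (ip f \<psi>) \<le> N * (T powr a / c) + M * T * norm (ip f \<psi>)"
        using M \<open>0 \<le> N\<close> elim(2) by (intro add_mono mult_left_mono mult_right_mono) auto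
      moreover have "norm (h s) \<le> norm (p0 * ip f \<psi>) + norm (h s - p0 * ip f \<psi>)"
        by (metis norm_triangle_sub)
      ultimately show ?case using elim(1) by linarith
    qed
    define b where "b = a - \<gamma>"
    have b: "0 < b" "b < 1" using a \<open>0 \<le> \<gamma>\<close> by (auto simp: b_def)
    have "AE t in ?M. ip (u t) \<psi> = frac_integral a h t"
      using uw frac_integral_bounded_linear[OF bounded_linear_ip_left a(1) w2, of \<psi>]
      unfolding h_def by eventually_elim simp
    then have "has_cont_frac_deriv T \<gamma> (\<lambda>t. ip (u t) \<psi>) (frac_integral b h)"
      unfolding b_def using a \<open>0 \<le> \<gamma>\<close> by (intro has_cont_frac_deriv_frac_integral[OF _ _ _ hm h_bound]) auto
    moreover have "norm (frac_integral b h t - p0 * ip f \<psi> * of_real (t powr (a - \<gamma>) / Gamma (1 + a - \<gamma>)))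
        \<le> (K / c + 1) * t powr (2 * a - \<gamma>)" if t: "t \<in> {0<..min 1 T}" for t
    proof -
      have tT: "0 \<le> t" "t \<le> T" using t by auto
      have K1: "has_bochner_integral ?M (\<lambda>s. frac_kern b (t - s)) (frac_kern (b + 1) t)"
        by (rule frac_kern_integral[OF b(1) tT])
      have exps: "a - \<gamma> = b" "1 + a - \<gamma> = b + 1" by (simp_all add: b_def)
      have "frac_integral b (\<lambda>s. h s - p0 * ip f \<psi>) t
          = (LINT s|?M. frac_kern b (t - s) *\<^sub>R h s - frac_kern b (t - s) *\<^sub>R (p0 * ip f \<psi>))"
        using b tT by (simp add: frac_integral_kern[of _ _ T] scaleR_diff_right)
      also have "\<dots> = (LINT s|?M. frac_kern b (t - s) *\<^sub>R h s) - (LINT s|?M. frac_kern b (t - s) *\<^sub>R (p0 * ip f \<psi>))"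
      proof (rule Bochner_Integration.integral_diff)
        show "integrable ?M (\<lambda>s. frac_kern b (t - s) *\<^sub>R h s)"
          using h_bound by (intro frac_kern_scaleR_integrable[OF b(1) tT hm]) (rule AE_mp, auto)
        show "integrable ?M (\<lambda>s. frac_kern b (t - s) *\<^sub>R (p0 * ip f \<psi>))"
          using has_bochner_integral_scaleR_left[OF K1] has_bochner_integral_iff by blast
      qed
      also have "(LINT s|?M. frac_kern b (t - s) *\<^sub>R (p0 * ip f \<psi>)) = frac_kern (b + 1) t *\<^sub>R (p0 * ip f \<psi>)"
        by (rule has_bochner_integral_integral_eq[OF has_bochner_integral_scaleR_left[OF K1]])
      also have "(LINT s|?M. frac_kern b (t - s) *\<^sub>R h s) = frac_integral b h t"
        using b tT by (simp add: frac_integral_kern[of _ _ T])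
      also have "frac_kern (b + 1) t *\<^sub>R (p0 * ip f \<psi>) = p0 * ip f \<psi> * of_real (t powr (a - \<gamma>) / Gamma (1 + a - \<gamma>))"
        unfolding exps using t by (simp add: frac_kern_def scaleR_conv_of_real mult.commute)
      finally have "norm (frac_integral b h t - p0 * ip f \<psi> * of_real (t powr (a - \<gamma>) / Gamma (1 + a - \<gamma>)))
          = norm (frac_integral b (\<lambda>s. h s - p0 * ip f \<psi>) t)" by simp
      also have "\<dots> \<le> K * t powr a * frac_kern (b + 1) t"
        using h_le[OF t] by (intro frac_integral_norm_le[OF b(1) tT]) auto
      also have "\<dots> \<le> K * t powr a * (t powr b / c)"
        using \<open>0 \<le> K\<close> b by (intro mult_left_mono frac_kern_le) auto
      also have "\<dots> = K / c * t powr (2 * a - \<gamma>)"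
        by (simp add: b_def flip: powr_add)
      also have "\<dots> \<le> (K / c + 1) * t powr (2 * a - \<gamma>)"
        by (intro mult_right_mono) auto
      finally show ?thesis .
    qed
    ultimately show ?thesis by blast
  qed
  have "0 < K / c + 1" using \<open>0 \<le> K\<close> c by (simp add: add_nonneg_pos)
  then show ?thesis
    using main \<open>T > 0\<close> by (intro exI[of _ "min 1 T"] exI[of _ "K / c + 1"]) auto
qed

end
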